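(* There is a class of subcubic trees (trees of maximum degree at most $3$) that has bounded radius-$r$ blind cop-width for every positive integer $r$ and unbounded pathwidth, and consequently has bounded blind flip-width and unbounded linear clique-width.
   Context: All graphs are finite, simple and undirected. For a graph $G$ and a positive integer $r$, a blind strategy of radius $r$ is a sequence $C_1,\dots,C_m\subseteq V(G)$ using $\max_i|C_i|$ cops, with $A_1=V(G)\setminus C_1$ and $A_{i+1}$ the set of $u\in V(G)\setminus C_{i+1}$ reachable from some vertex of $A_i$ by a path of length at most $r$ (length $0$ allowed) in $G\setminus(C_i\cap C_{i+1})$; it is winning if $A_m=\emptyset$. $\mathrm{bcw}_r(G)$ is the minimum number of cops of a winning strategy. A class $\mathscr C$ has bounded radius-$r$ blind cop-width if $\sup_{G\in\mathscr C}\mathrm{bcw}_r(G)<\infty$. A $k$-flip of $G$ is a pair $(\mathcal P,F)$ where $\mathcal P$ is a partition of $V(G)$ into at most $k$ parts and $F$ is a graph (loops allowed) on vertex set $\mathcal P$; flipping $G$ by $(\mathcal P,F)$ yields the graph on $V(G)$ in which distinct $u,v$ with parts $P\ni u$, $Q\ni v$ are adjacent iff exactly one of $\{u,v\}\in E(G)$ and $\{P,Q\}\in E(F)$ holds. In the blind radius-$r$ flipper game, the flipper fixes in advance a sequence of $k$-flips $f_1,\dots,f_m$; let $G_0=G$ and $G_i$ be $G$ flipped by $f_i$. Let $R_0$ be the set of non-isolated vertices of $G_0$ and, for $i\ge1$, $R_i$ the set of vertices that are non-isolated in $G_i$ and reachable by a path of length at most $r$ in $G_{i-1}$ from some vertex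 of $R_{i-1}$. The flipper wins if $R_m=\emptyset$. The radius-$r$ blind flip-width $\mathrm{bfw}_r(G)$ is the minimum $k$ for which the flipper has a winning sequence of $k$-flips. A class $\mathscr C$ has bounded blind flip-width if there is $f:\mathbb N\to\mathbb N$ with $\mathrm{bfw}_r(G)\le f(r)$ for all $r\in\mathbb N$ and $G\in\mathscr C$. Linear clique-width is the standard graph parameter (the linear version of clique-width). *)

theory Defs
  imports "Graph_Theory.Graph_Theory" "HOL-Library.Disjoint_Sets"
begin

text \<open>
  Finite simple undirected graphs are the symmetric loop-free digraphs of locale
  \<^locale>\<open>pair_graph\<close>; an undirected edge is a pair of opposite arcs.
\<close>

subsection \<open>Subcubic trees\<close>

text \<open>
  The constant \<^const>\<open>tree\<close> of the library cannot be used: in a symmetric digraph it regards the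
  closed walk \<open>u, v, u\<close> along a single edge as a cycle.
\<close>

definition undirected_cycle :: "'a pair_pre_digraph \<Rightarrow> 'a list \<Rightarrow> bool" where
  "undirected_cycle G p \<longleftrightarrow>
     vpath p (with_proj G) \<and> length p \<ge> 3 \<and> (last p, hd p) \<in> parcs G"

definition undirected_tree :: "'a pair_pre_digraph \<Rightarrow> bool" where
  "undirected_tree G \<longleftrightarrow>
     pair_graph G \<and> Digraph_Component.connected (with_proj G) \<and> (\<nexists>p. undirected_cycle G p)"

definition subcubic :: "'a pair_pre_digraph \<Rightarrow> bool" where
  "subcubic G \<longleftrightarrow> (\<forall>v \<in> pverts G. out_degree (with_proj G) v \<le> 3)"

subsection \<open>Pathwidth\<close>

definition path_decomposition :: "'a pair_pre_digraph \<Rightarrow> 'a set list \<Rightarrow> bool" where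
  "path_decomposition G Xs \<longleftrightarrow>
     Xs \<noteq> [] \<and>
     \<Union> (set Xs) = pverts G \<and>
     (\<forall>(u, v) \<in> parcs G. \<exists>X \<in> set Xs. u \<in> X \<and> v \<in> X) \<and>
     (\<forall>i j k. i \<le> j \<and> j \<le> k \<and> k < length Xs \<longrightarrow> Xs ! i \<inter> Xs ! k \<subseteq> Xs ! j)"

text \<open>The subtraction truncates only for the graph without vertices.\<close>

definition decomposition_width :: "'a set list \<Rightarrow> nat" where
  "decomposition_width Xs = Max (card ` set Xs) - 1"

definition pathwidth :: "'a pair_pre_digraph \<Rightarrow> nat" where
  "pathwidth G = (LEAST w. \<exists>Xs. path_decomposition G Xs \<and> decomposition_width Xs = w)"

subsection \<open>Blind cop-width\<close>

definition reach_within :: "nat \<Rightarrow> ('a, 'b) pre_digraph \<Rightarrow> 'a \<Rightarrow> 'a \<Rightarrow> bool" where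
  "reach_within r H u v \<longleftrightarrow>
     (\<exists>p. vpath p H \<and> hd p = u \<and> last p = v \<and> vwalk_length p \<le> r)"

definition blind_strategy :: "'a pair_pre_digraph \<Rightarrow> 'a set list \<Rightarrow> bool" where
  "blind_strategy G Cs \<longleftrightarrow> Cs \<noteq> [] \<and> (\<forall>C \<in> set Cs. C \<subseteq> pverts G)"

definition num_cops :: "'a set list \<Rightarrow> nat" where
  "num_cops Cs = Max (card ` set Cs)"

text \<open>Lists are indexed from \<open>0\<close>: \<open>Cs ! i\<close> is $C_{i+1}$ and \<open>robber_area r G Cs i\<close> is $A_{i+1}$.\<close>

primrec robber_area ::
  "nat \<Rightarrow> 'a pair_pre_digraph \<Rightarrow> 'a set list \<Rightarrow> nat \<Rightarrow> 'a set" where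
  "robber_area r G Cs 0 = pverts G - Cs ! 0"
| "robber_area r G Cs (Suc i) =
     {u \<in> pverts G - Cs ! Suc i. \<exists>a \<in> robber_area r G Cs i.
        reach_within r (with_proj G \<restriction> (pverts G - (Cs ! i \<inter> Cs ! Suc i))) a u}"

definition cops_win :: "nat \<Rightarrow> 'a pair_pre_digraph \<Rightarrow> 'a set list \<Rightarrow> bool" where
  "cops_win r G Cs \<longleftrightarrow> blind_strategy G Cs \<and> robber_area r G Cs (length Cs - 1) = {}"

definition bcw :: "nat \<Rightarrow> 'a pair_pre_digraph \<Rightarrow> nat" where
  "bcw r G = (LEAST k. \<exists>Cs. cops_win r G Cs \<and> num_cops Cs = k)"

definition bounded_bcw :: "nat \<Rightarrow> 'a pair_pre_digraph set \<Rightarrow> bool" where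
  "bounded_bcw r \<C> \<longleftrightarrow> bdd_above (bcw r ` \<C>)"

subsection \<open>Blind flip-width\<close>

text \<open>The graph of part pairs to be flipped is a \<^locale>\<open>pair_pseudo_graph\<close>: it may have loops.\<close>

type_synonym 'a flip = "'a set set \<times> 'a set pair_pre_digraph"

definition is_flip :: "nat \<Rightarrow> 'a pair_pre_digraph \<Rightarrow> 'a flip \<Rightarrow> bool" where
  "is_flip k G f \<longleftrightarrow> (case f of (\<P>, F) \<Rightarrow>
     partition_on (pverts G) \<P> \<and> card \<P> \<le> k \<and> pair_pseudo_graph F \<and> pverts F = \<P>)"

definition flip_graph :: "'a pair_pre_digraph \<Rightarrow> 'a flip \<Rightarrow> 'a pair_pre_digraph" where
  "flip_graph G f = (case f of (\<P>, F) \<Rightarrow>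
     \<lparr> pverts = pverts G,
       parcs = {(u, v). u \<in> pverts G \<and> v \<in> pverts G \<and> u \<noteq> v \<and>
         ((u, v) \<in> parcs G) \<noteq> (\<exists>P \<in> \<P>. \<exists>Q \<in> \<P>. u \<in> P \<and> v \<in> Q \<and> (P, Q) \<in> parcs F)} \<rparr>)"

definition nonisolated :: "'a pair_pre_digraph \<Rightarrow> 'a set" where
  "nonisolated G = {v \<in> pverts G. \<exists>w. (v, w) \<in> parcs G}"

text \<open>The graph $G_i$: \<open>fs ! i\<close> is $f_{i+1}$.\<close>

primrec flipped_graph :: "'a pair_pre_digraph \<Rightarrow> 'a flip list \<Rightarrow> nat \<Rightarrow> 'a pair_pre_digraph" where
  "flipped_graph G fs 0 = G"
| "flipped_graph G fs (Suc i) = flip_graph G (fs ! i)"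

primrec runner_area :: "nat \<Rightarrow> 'a pair_pre_digraph \<Rightarrow> 'a flip list \<Rightarrow> nat \<Rightarrow> 'a set" where
  "runner_area r G fs 0 = nonisolated (flipped_graph G fs 0)"
| "runner_area r G fs (Suc i) =
     {v \<in> nonisolated (flipped_graph G fs (Suc i)). \<exists>u \<in> runner_area r G fs i.
        reach_within r (with_proj (flipped_graph G fs i)) u v}"

definition flipper_wins :: "nat \<Rightarrow> nat \<Rightarrow> 'a pair_pre_digraph \<Rightarrow> 'a flip list \<Rightarrow> bool" where
  "flipper_wins r k G fs \<longleftrightarrow>
     fs \<noteq> [] \<and> (\<forall>f \<in> set fs. is_flip k G f) \<and> runner_area r G fs (length fs) = {}"

definition bfw :: "nat \<Rightarrow> 'a pair_pre_digraph \<Rightarrow> nat" where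
  "bfw r G = (LEAST k. \<exists>fs. flipper_wins r k G fs)"

definition bounded_bfw :: "'a pair_pre_digraph set \<Rightarrow> bool" where
  "bounded_bfw \<C> \<longleftrightarrow> (\<exists>f :: nat \<Rightarrow> nat. \<forall>r. \<forall>G \<in> \<C>. bfw r G \<le> f r)"

subsection \<open>Linear clique-width\<close>

text \<open>
  \<open>linear_expr k G l\<close>: the graph \<open>G\<close> with vertex labelling \<open>l\<close> is the value of a linear
  \<open>k\<close>-expression, with labels \<open>0, \<dots>, k - 1\<close>.  Disjoint union is only available with a single
  labelled vertex.  Starting from the graph without vertices also covers the creation of a first
  vertex.  Values of \<open>l\<close> outside the vertex set are irrelevant.
\<close>

inductive linear_expr :: "nat \<Rightarrow> 'a pair_pre_digraph \<Rightarrow> ('a \<Rightarrow> nat) \<Rightarrow> bool" for k where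
  empty: "linear_expr k \<lparr> pverts = {}, parcs = {} \<rparr> l"
| new_vertex:
    "\<lbrakk>linear_expr k G l; v \<notin> pverts G; i < k\<rbrakk> \<Longrightarrow>
     linear_expr k \<lparr> pverts = insert v (pverts G), parcs = parcs G \<rparr> (l(v := i))"
| join:
    "\<lbrakk>linear_expr k G l; i < k; j < k; i \<noteq> j\<rbrakk> \<Longrightarrow>
     linear_expr k
       \<lparr> pverts = pverts G,
         parcs = parcs G \<union>
           {(u, v). u \<in> pverts G \<and> v \<in> pverts G \<and>
              (l u = i \<and> l v = j \<or> l u = j \<and> l v = i)} \<rparr> l"
| relabel:
    "\<lbrakk>linear_expr k G l; i < k; j < k\<rbrakk> \<Longrightarrow>
     linear_expr k G (\<lambda>v. if l v = i then j else l v)"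

definition linear_cliquewidth :: "'a pair_pre_digraph \<Rightarrow> nat" where
  "linear_cliquewidth G = (LEAST k. \<exists>l. linear_expr k G l)"

end

theory Submission
  imports Defs
begin

text \<open>
  Take complete binary trees in which the edges towards the root are subdivided more and more often.
  A blind robber of speed \<open>r\<close> needs time to travel along a subdivided edge.  So four cops can search
  the left branch below a vertex, then the right branch, and find that the tail leading to the left
  branch has not been traversed meanwhile, provided that it is longer than \<open>r\<close> times the duration of
  the search of the right branch; then they sweep both tails upwards simultaneously.  The tails
  of the \<open>d\<close>-th tree are long enough for all speeds up to \<open>d\<close>, hence for a fixed speed only finitely
  many trees of the class are exceptional.

  Both a path decomposition and a linear clique-width expression yield an ordering of the vertices
  all of whose cuts are small.  Three disjoint copies of a subtree force a cut that is larger by one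
  than the subtree itself forces, so the cuts of the trees in the class are unbounded.

  For bounded degree, a flip with boundedly many parts can isolate the positions of the cops, so the
  flipper can imitate the cops.
\<close>

subsection \<open>Binary trees in heap numbering\<close>

text \<open>The parent of \<open>v\<close> is \<open>v div 2\<close>; the root of a tree is its smallest number.\<close>

definition desc :: "nat \<Rightarrow> nat set" where
  "desc w = {v. \<exists>j. v div 2 ^ j = w}"

lemma desc_refl [simp]: "w \<in> desc w"
  by (auto simp: desc_def intro: exI[of _ 0])

lemma desc_trans: "u \<in> desc v \<Longrightarrow> v \<in> desc w \<Longrightarrow> u \<in> desc w"
  by (auto simp: desc_def simp flip: div_mult2_eq power_add)

lemma desc_subset: "v \<in> desc w \<Longrightarrow> desc v \<subseteq> desc w"
  using desc_trans by auto

lemma desc_mult_power: "w * 2 ^ j \<in> desc w"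
  by (auto simp: desc_def intro: exI[of _ j])

lemma desc_even [simp]: "2 * w \<in> desc w" and desc_odd [simp]: "Suc (2 * w) \<in> desc w"
  by (auto simp: desc_def intro: exI[of _ 1])

lemma desc_of_half: "v div 2 \<in> desc w \<Longrightarrow> v \<in> desc w"
  by (rule desc_trans[of v "v div 2"]) (auto simp: desc_def intro: exI[of _ 1])

lemma half_in_desc:
  assumes "v \<in> desc w" "v \<noteq> w"
  shows "v div 2 \<in> desc w"
proof -
  obtain j where j: "v div 2 ^ j = w" using assms by (auto simp: desc_def)
  with assms obtain i where "j = Suc i" by (cases j) auto
  with j show ?thesis by (auto simp: desc_def div_mult2_eq)
qed

lemma desc_ge: "v \<in> desc w \<Longrightarrow> w \<le> v"
  by (auto simp: desc_def)

text \<open>If the distances \<open>i\<close> and \<open>j\<close> from a common descendant differ,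
  one child arises from the other by halving at least once and so is at most \<open>w\<close>, which
  is impossible for \<open>0 < w\<close>. The number 0 is its own even child.\<close>

lemma desc_children_disjoint:
  assumes "0 < w"
  shows "desc (2 * w) \<inter> desc (Suc (2 * w)) = {}"
proof (rule ccontr)
  assume "\<not> ?thesis"
  then obtain v i j where v: "v div 2 ^ i = 2 * w" "v div 2 ^ j = Suc (2 * w)"
    by (auto simp: desc_def)
  consider "i = j" | k where "j = i + Suc k" | k where "i = j + Suc k"
    by (metis less_imp_Suc_add linorder_neqE_nat add_Suc_right)
  then show False
  proof cases
    case 1 with v show False by auto
  next
    case 2
    then have "Suc (2 * w) = 2 * w div 2 ^ Suc k"
      by (metis v power_add div_mult2_eq)
    moreover have "2 * w div 2 ^ Suc k \<le> 2 * w" by (rule div_le_dividend)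
    ultimately show False by linarith
  next
    case 3
    then have "2 * w = Suc (2 * w) div 2 ^ Suc k"
      by (metis v power_add div_mult2_eq)
    moreover have "Suc (2 * w) div 2 ^ Suc k = w div 2 ^ k" by (simp add: div_mult2_eq)
    moreover have "w div 2 ^ k \<le> w" by (rule div_le_dividend)
    ultimately show False using assms by linarith
  qed
qed

section \<open>Shapes of binary trees and their vertex sets\<close>

datatype shape = Leaf | One shape | Two shape shape

text \<open>An only child is always the even one, so the tail \<open>(One ^^ l) t\<close> below
  \<open>w\<close> carries \<open>t\<close> at \<open>w * 2 ^ l\<close>.\<close>

primrec places :: "shape \<Rightarrow> nat \<Rightarrow> nat set" where
  "places Leaf w = {w}"
| "places (One t) w = insert w (places t (2 * w))"
| "places (Two s t) w = insert w (places s (2 * w) \<union> places t (Suc (2 * w)))"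

lemma finite_places [simp]: "finite (places t w)"
  by (induction t arbitrary: w) auto

lemma root_in_places [simp]: "w \<in> places t w"
  by (cases t) auto

lemma places_subset_desc: "places t w \<subseteq> desc w"
proof (induction t arbitrary: w)
  case (One t)
  from One[of "2 * w"] show ?case by (auto intro: desc_trans[OF _ desc_even])
next
  case (Two s t)
  from Two(1)[of "2 * w"] Two(2)[of "Suc (2 * w)"] show ?case
    by (auto intro: desc_trans[OF _ desc_even] desc_trans[OF _ desc_odd])
qed auto

lemma half_in_places:
  assumes "v \<in> places t w" "v \<noteq> w"
  shows "v div 2 \<in> places t w"
  using assms
proof (induction t arbitrary: w)
  case (One t)
  then show ?case by (cases "v = 2 * w") auto
next
  case (Two s t)
  then show ?case
    by (cases "v = 2 * w"; cases "v = Suc (2 * w)") auto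
qed auto

lemma zero_notin_places: "0 < w \<Longrightarrow> 0 \<notin> places t w"
  using places_subset_desc desc_ge by fastforce

lemma places_chain: "places t (w * 2 ^ l) \<subseteq> places ((One ^^ l) t) w"
proof (induction l arbitrary: w)
  case (Suc l)
  from Suc[of "2 * w"] show ?case by (auto simp: mult.left_commute mult.assoc)
qed auto

section \<open>Heap graphs as subcubic trees\<close>

definition heap_graph :: "nat set \<Rightarrow> nat pair_pre_digraph" where
  "heap_graph V =
     \<lparr> pverts = V, parcs = {(u, v). u \<in> V \<and> v \<in> V \<and> (u = v div 2 \<or> v = u div 2)} \<rparr>"

lemma heap_graph_simps [simp]:
  "pverts (heap_graph V) = V"
  "(u, v) \<in> parcs (heap_graph V) \<longleftrightarrow> u \<in> V \<and> v \<in> V \<and> (u = v div 2 \<or> v = u div 2)"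
  by (auto simp: heap_graph_def)

lemma heap_graph_neighbours:
  "{v. (u, v) \<in> parcs (heap_graph V)} \<subseteq> {u div 2, 2 * u, Suc (2 * u)}"
  by auto

lemma card_heap_graph_neighbours: "card {v. (u, v) \<in> parcs (heap_graph V)} \<le> 3"
proof -
  have "card {v. (u, v) \<in> parcs (heap_graph V)} \<le> card {u div 2, 2 * u, Suc (2 * u)}"
    by (rule card_mono[OF _ heap_graph_neighbours]) auto
  also have "\<dots> \<le> 3" by (auto simp: card_insert_if)
  finally show ?thesis .
qed

lemma subcubic_heap_graph: "subcubic (heap_graph V)"
  unfolding subcubic_def
proof
  fix u assume "u \<in> pverts (heap_graph V)"
  have "out_arcs (with_proj (heap_graph V)) u = Pair u ` {v. (u, v) \<in> parcs (heap_graph V)}"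
    by (auto simp: out_arcs_def)
  then show "out_degree (with_proj (heap_graph V)) u \<le> 3"
    using card_heap_graph_neighbours[of u V] unfolding out_degree_def
    by (simp add: card_image inj_on_def)
qed

lemma half_eq_self: "n = n div 2 \<longleftrightarrow> n = 0" for n :: nat
  by auto

text \<open>Since \<open>0 div 2 = 0\<close>, the number 0 would carry a loop; positive roots keep
  it out of the trees.\<close>

lemma pair_graph_heap_graph:
  assumes "finite V" "0 \<notin> V"
  shows "pair_graph (heap_graph V)"
proof
  have "parcs (heap_graph V) \<subseteq> V \<times> V" by auto
  then show "finite (parcs (heap_graph V))" by (rule finite_subset) (use assms in auto)
  show "fst e \<noteq> snd e" if "e \<in> parcs (heap_graph V)" for e
    using that assms by (cases e) (auto simp: half_eq_self)
  show "symmetric (with_proj (heap_graph V))"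
    unfolding symmetric_def by (auto simp: sym_def)
qed (use assms in auto)

lemma vwalk_arcs_nth:
  "Suc i < length p \<Longrightarrow> (p ! i, p ! Suc i) \<in> set (vwalk_arcs p)"
  by (induction p arbitrary: i rule: vwalk_arcs.induct) (auto simp: nth_Cons split: nat.split)

text \<open>Both cycle neighbours of the largest vertex of a cycle would have to be its parent.\<close>

lemma heap_graph_acyclic:
  assumes "0 \<notin> V"
  shows "\<not> undirected_cycle (heap_graph V) p"
proof
  assume "undirected_cycle (heap_graph V) p"
  then have p: "set p \<subseteq> V" "set (vwalk_arcs p) \<subseteq> parcs (heap_graph V)" "distinct p" "p \<noteq> []"
    and len: "length p \<ge> 3" and closing: "(last p, hd p) \<in> parcs (heap_graph V)"
    by (auto simp: undirected_cycle_def vpath_def vwalk_def)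
  define n where "n = length p"
  define nxt where "nxt i = Suc i mod n" for i
  have n: "n \<ge> 3" using len by (simp add: n_def)
  have adj: "(p ! i, p ! nxt i) \<in> parcs (heap_graph V)" if "i < n" for i
  proof (cases "Suc i = n")
    case True
    then have "i = length p - 1" "p ! nxt i = hd p"
      using p by (auto simp: nxt_def n_def last_conv_nth hd_conv_nth )
    then show ?thesis using closing p by (simp add: last_conv_nth)
  next
    case False
    then show ?thesis
      using that p(2) vwalk_arcs_nth[of i p] by (auto simp: nxt_def n_def)
  qed
  have "Max (set p) \<in> set p" using p by simp
  then obtain i where i: "i < n" "p ! i = Max (set p)"
    by (auto simp: in_set_conv_nth n_def)
  \<comment> \<open>The cyclic predecessor of the position \<open>i\<close> of the maximum. Length
    at least 3 makes it differ from the successor \<open>nxt i\<close>.\<close>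
  define h where "h = (if i = 0 then n - 1 else i - 1)"
  have h: "h < n" "nxt h = i" "h \<noteq> nxt i" "nxt i < n"
    using i n by (auto simp: h_def nxt_def mod_Suc)
  have below: "x = Max (set p) div 2"
    if "x \<in> set p" "x = Max (set p) div 2 \<or> Max (set p) = x div 2" for x
  proof -
    have "x \<in> V" using that(1) p(1) by (rule subsetD[rotated])
    then have "x \<noteq> 0" using assms by metis
    moreover have "x \<le> Max (set p)" using that(1) by simp
    ultimately show ?thesis using that(2) by linarith
  qed
  have "p ! h = Max (set p) div 2"
    using adj[OF h(1)] h i by (intro below) (auto simp: n_def)
  moreover have "p ! nxt i = Max (set p) div 2"
    using adj[OF i(1)] h i by (intro below) (auto simp: n_def)
  ultimately show False
    using h p(3) nth_eq_iff_index_eq[of p h "nxt i"] by (simp add: n_def)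
qed

lemma undirected_tree_heap_graph:
  assumes "0 < w"
  shows "undirected_tree (heap_graph (places t w))"
proof -
  let ?G = "heap_graph (places t w)"
  let ?R = "rtrancl_on (places t w) ((parcs ?G)\<^sup>s)"
  \<comment> \<open>Repeated halving leads from \<open>v\<close> to the root through smaller and
    smaller numbers.\<close>
  have to_root: "(v, w) \<in> ?R \<and> (w, v) \<in> ?R" if "v \<in> places t w" for v
    using that
  proof (induction v rule: less_induct)
    case (less v)
    show ?case
    proof (cases "v = w")
      case False
      have v: "v \<noteq> 0" using less.prems zero_notin_places[OF assms] by metis
      have half: "v div 2 \<in> places t w" using half_in_places less.prems False by blast
      then have "(v div 2, w) \<in> ?R" "(w, v div 2) \<in> ?R" using less v by auto
      moreover have "(v, v div 2) \<in> (parcs ?G)\<^sup>s" "(v div 2, v) \<in> (parcs ?G)\<^sup>s"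
        using less.prems half by (auto simp: symcl_def)
      ultimately show ?thesis
        using less.prems half
        by (meson converse_rtrancl_on_into_rtrancl_on rtrancl_on_into_rtrancl_on)
    qed (use less in auto)
  qed
  have "Digraph_Component.connected (with_proj ?G)"
    unfolding connected_conv
  proof (intro conjI ballI)
    show "verts (with_proj ?G) \<noteq> {}"
      using root_in_places[of w t] by (metis empty_iff heap_graph_simps(1) with_proj_simps(1))
    show "(u, v) \<in> rtrancl_on (verts (with_proj ?G)) ((arcs_ends (with_proj ?G))\<^sup>s)"
      if "u \<in> verts (with_proj ?G)" "v \<in> verts (with_proj ?G)" for u v
      using that to_root by (auto intro: rtrancl_on_trans)
  qed
  then show ?thesis
    unfolding undirected_tree_def
    using pair_graph_heap_graph[OF finite_places zero_notin_places[OF assms]]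
      heap_graph_acyclic[OF zero_notin_places[OF assms]] by blast
qed

subsection \<open>Cuts of vertex orderings\<close>

text \<open>The root is left out because the half of a positive root lies outside the tree, so the
  root stands for no edge.\<close>

definition cut :: "(nat \<Rightarrow> nat) \<Rightarrow> nat \<Rightarrow> nat set \<Rightarrow> nat \<Rightarrow> nat set" where
  "cut \<tau> s U w = {v \<in> U - {w}. (\<tau> v < s) \<noteq> (\<tau> (v div 2) < s)}"

text \<open>
  Think of \<open>\<tau>\<close> as arrival times of the vertices, at most \<open>m\<close> at a time.  Each edge is represented by
  its lower end.
\<close>

definition wide :: "nat \<Rightarrow> nat \<Rightarrow> shape \<Rightarrow> bool" where
  "wide m k t \<longleftrightarrow> (\<forall>w > 0. \<forall>\<tau>. (\<forall>i. card {v \<in> places t w. \<tau> v = i} \<le> m) \<longrightarrow>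
     (\<exists>s. k \<le> card (cut \<tau> s (places t w) w)))"

text \<open>Somewhere on the path of halves from \<open>x\<close> to the root the side of the
  threshold changes. The clause \<open>x \<in> desc v\<close> later shows that this edge is not part
  of a subtree that misses \<open>x\<close>.\<close>

lemma cut_between_root:
  assumes "0 < w" "x \<in> places t w" "(\<tau> x < s) \<noteq> (\<tau> w < s)"
  shows "\<exists>v \<in> cut \<tau> s (places t w) w. x \<in> desc v"
  using assms(2,3)
proof (induction x rule: less_induct)
  case (less x)
  then have "x \<noteq> w" by auto
  show ?case
  proof (cases "(\<tau> x < s) = (\<tau> (x div 2) < s)")
    case True
    have "x \<noteq> 0" using less.prems zero_notin_places[OF assms(1)] by metis
    then have "x div 2 < x" by auto
    then obtain v where "v \<in> cut \<tau> s (places t w) w" "x div 2 \<in> desc v"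
      using less True half_in_places \<open>x \<noteq> w\<close> by metis
    then show ?thesis using desc_of_half by blast
  next
    case False
    then have "x \<in> cut \<tau> s (places t w) w" using less.prems \<open>x \<noteq> w\<close> by (auto simp: cut_def)
    then show ?thesis using desc_refl by blast
  qed
qed

lemma cut_early_late:
  assumes "cut \<tau> s (places t w) w \<noteq> {}"
  obtains x y where "x \<in> places t w" "\<tau> x < s" "y \<in> places t w" "s \<le> \<tau> y"
proof -
  obtain v where v: "v \<in> places t w" "v \<noteq> w" "(\<tau> v < s) \<noteq> (\<tau> (v div 2) < s)"
    using assms by (auto simp: cut_def)
  then have "v div 2 \<in> places t w" by (intro half_in_places)
  with v that show thesis by (metis not_less)
qed

text \<open>
  At the middle time the first subtree has been entered and the third one is not exhausted, so the
  connection between them outside the second subtree contributes one more edge to the cut.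
\<close>

lemma cut_median:
  assumes "0 < w"
    and sub: "places t\<^sub>1 w\<^sub>1 \<subseteq> places t w" "places t\<^sub>2 w\<^sub>2 \<subseteq> places t w" "places t\<^sub>3 w\<^sub>3 \<subseteq> places t w"
    and disj: "desc w\<^sub>1 \<inter> desc w\<^sub>2 = {}" "desc w\<^sub>2 \<inter> desc w\<^sub>3 = {}"
    and times: "s\<^sub>1 \<le> s\<^sub>2" "s\<^sub>2 \<le> s\<^sub>3"
    and cuts: "cut \<tau> s\<^sub>1 (places t\<^sub>1 w\<^sub>1) w\<^sub>1 \<noteq> {}" "cut \<tau> s\<^sub>3 (places t\<^sub>3 w\<^sub>3) w\<^sub>3 \<noteq> {}"
  shows "card (cut \<tau> s\<^sub>2 (places t\<^sub>2 w\<^sub>2) w\<^sub>2) < card (cut \<tau> s\<^sub>2 (places t w) w)"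
proof -
  obtain x where x: "x \<in> places t\<^sub>1 w\<^sub>1" "\<tau> x < s\<^sub>1" using cuts(1) by (rule cut_early_late)
  obtain y where y: "y \<in> places t\<^sub>3 w\<^sub>3" "s\<^sub>3 \<le> \<tau> y" using cuts(2) by (rule cut_early_late)
  have "(\<tau> x < s\<^sub>2) \<noteq> (\<tau> y < s\<^sub>2)" using x y times by auto
  \<comment> \<open>As \<open>x\<close> and \<open>y\<close> are on different sides of the
    threshold, one of them is on the side opposite to the root.\<close>
  then obtain z where z: "z \<in> {x, y}" "(\<tau> z < s\<^sub>2) \<noteq> (\<tau> w < s\<^sub>2)" by auto
  then have "z \<in> places t w" using x y sub by auto
  then obtain v where v: "v \<in> cut \<tau> s\<^sub>2 (places t w) w" "z \<in> desc v"
    using cut_between_root[OF assms(1) _ z(2)] by blast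
  have "z \<notin> desc w\<^sub>2"
    using z x y disj places_subset_desc[of t\<^sub>1 w\<^sub>1] places_subset_desc[of t\<^sub>3 w\<^sub>3] by auto
  then have "v \<notin> places t\<^sub>2 w\<^sub>2"
    using v(2) desc_trans[of z v w\<^sub>2] places_subset_desc[of t\<^sub>2 w\<^sub>2] by auto
  \<comment> \<open>The cut of the large tree omits its root, so for the inclusion of cuts the root
    must not be counted in the cut of the subtree.\<close>
  moreover have "w \<notin> places t\<^sub>2 w\<^sub>2 - {w\<^sub>2}"
  proof
    assume *: "w \<in> places t\<^sub>2 w\<^sub>2 - {w\<^sub>2}"
    have "w\<^sub>2 \<in> places t w" using sub by auto
    then have "w \<le> w\<^sub>2" using places_subset_desc[of t w] desc_ge by auto
    moreover have "w\<^sub>2 \<le> w" using * places_subset_desc[of t\<^sub>2 w\<^sub>2] desc_ge by auto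
    ultimately show False using * by auto
  qed
  ultimately have "cut \<tau> s\<^sub>2 (places t\<^sub>2 w\<^sub>2) w\<^sub>2 \<subset> cut \<tau> s\<^sub>2 (places t w) w"
    using v(1) sub by (auto simp: cut_def)
  moreover have "finite (cut \<tau> s\<^sub>2 (places t w) w)" by (auto simp: cut_def)
  ultimately show ?thesis by (rule psubset_card_mono[rotated])
qed

text \<open>Each copy has a critical time at which its own cut has \<open>Suc k\<close> edges. After
  sorting the three times, the copy with the middle one gains an edge by \<open>cut_median\<close>;
  positivity of \<open>Suc k\<close> makes the other two cuts nonempty.\<close>

lemma wide_Suc:
  assumes t: "wide m (Suc k) t" and "0 < w"
    and sub: "places t w\<^sub>1 \<subseteq> places u w" "places t w\<^sub>2 \<subseteq> places u w" "places t w\<^sub>3 \<subseteq> places u w"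
    and disj: "desc w\<^sub>1 \<inter> desc w\<^sub>2 = {}" "desc w\<^sub>1 \<inter> desc w\<^sub>3 = {}" "desc w\<^sub>2 \<inter> desc w\<^sub>3 = {}"
    and fibres: "\<forall>i. card {v \<in> places u w. \<tau> v = i} \<le> m"
  shows "\<exists>s. Suc (Suc k) \<le> card (cut \<tau> s (places u w) w)"
proof -
  have *: "\<exists>s. Suc k \<le> card (cut \<tau> s (places t w') w')" if "places t w' \<subseteq> places u w" for w'
  proof -
    have "w' \<in> places u w" using that by auto
    then have "0 < w'" using zero_notin_places[OF \<open>0 < w\<close>] by (metis gr0I)
    moreover have "card {v \<in> places t w'. \<tau> v = i} \<le> m" for i
    proof -
      have "card {v \<in> places t w'. \<tau> v = i} \<le> card {v \<in> places u w. \<tau> v = i}"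
        by (rule card_mono) (use that in auto)
      then show ?thesis using fibres le_trans by blast
    qed
    ultimately show ?thesis using t by (auto simp: wide_def)
  qed
  obtain s\<^sub>1 s\<^sub>2 s\<^sub>3 where
    s: "Suc k \<le> card (cut \<tau> s\<^sub>1 (places t w\<^sub>1) w\<^sub>1)" "Suc k \<le> card (cut \<tau> s\<^sub>2 (places t w\<^sub>2) w\<^sub>2)"
      "Suc k \<le> card (cut \<tau> s\<^sub>3 (places t w\<^sub>3) w\<^sub>3)"
    using *[OF sub(1)] *[OF sub(2)] *[OF sub(3)] by blast
  then have ne: "cut \<tau> s\<^sub>1 (places t w\<^sub>1) w\<^sub>1 \<noteq> {}" "cut \<tau> s\<^sub>2 (places t w\<^sub>2) w\<^sub>2 \<noteq> {}"
    "cut \<tau> s\<^sub>3 (places t w\<^sub>3) w\<^sub>3 \<noteq> {}"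
    by force+
  have disj': "desc w\<^sub>2 \<inter> desc w\<^sub>1 = {}" "desc w\<^sub>3 \<inter> desc w\<^sub>1 = {}" "desc w\<^sub>3 \<inter> desc w\<^sub>2 = {}"
    using disj by blast+
  consider "s\<^sub>1 \<le> s\<^sub>2" "s\<^sub>2 \<le> s\<^sub>3" | "s\<^sub>3 \<le> s\<^sub>2" "s\<^sub>2 \<le> s\<^sub>1" 
    | "s\<^sub>2 \<le> s\<^sub>1" "s\<^sub>1 \<le> s\<^sub>3" | "s\<^sub>3 \<le> s\<^sub>1" "s\<^sub>1 \<le> s\<^sub>2"
    | "s\<^sub>1 \<le> s\<^sub>3" "s\<^sub>3 \<le> s\<^sub>2" | "s\<^sub>2 \<le> s\<^sub>3" "s\<^sub>3 \<le> s\<^sub>1" by linarith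
  then show ?thesis
  proof cases
    case 1
    from cut_median[OF \<open>0 < w\<close> sub(1,2,3) disj(1) disj(3) this ne(1,3)] s(2)
    show ?thesis by (meson Suc_leI le_less_trans)
  next
    case 2
    from cut_median[OF \<open>0 < w\<close> sub(3,2,1) disj'(3) disj'(1) this ne(3,1)] s(2)
    show ?thesis by (meson Suc_leI le_less_trans)
  next
    case 3
    from cut_median[OF \<open>0 < w\<close> sub(2,1,3) disj'(1) disj(2) this ne(2,3)] s(1)
    show ?thesis by (meson Suc_leI le_less_trans)
  next
    case 4
    from cut_median[OF \<open>0 < w\<close> sub(3,1,2) disj'(2) disj(1) this ne(3,2)] s(1)
    show ?thesis by (meson Suc_leI le_less_trans)
  next
    case 5
    from cut_median[OF \<open>0 < w\<close> sub(1,3,2) disj(2) disj'(3) this ne(1,2)] s(3)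
    show ?thesis by (meson Suc_leI le_less_trans)
  next
    case 6
    from cut_median[OF \<open>0 < w\<close> sub(2,3,1) disj(3) disj'(2) this ne(2,1)] s(3)
    show ?thesis by (meson Suc_leI le_less_trans)
  qed
qed

section \<open>Forks and growing cuts\<close>

definition fork :: "nat \<Rightarrow> shape \<Rightarrow> shape" where
  "fork l t = Two ((One ^^ l) t) ((One ^^ l) t)"

lemma places_fork:
  "places t (2 * w * 2 ^ l) \<subseteq> places (fork l t) w"
  "places t (Suc (2 * w) * 2 ^ l) \<subseteq> places (fork l t) w"
  using places_chain[of t "2 * w" l] places_chain[of t "Suc (2 * w)" l]
  by (auto simp: fork_def)

lemma desc_mult_power_subset: "desc (w * 2 ^ l) \<subseteq> desc w"
  by (rule desc_subset[OF desc_mult_power])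

text \<open>Two nested forks contain disjoint copies of \<open>t\<close> for
  \<open>wide_Suc\<close>: \<open>?w1\<close> and \<open>?w2\<close> lie below the left end
  \<open>a\<close>, \<open>?w3\<close> below the right end \<open>b\<close>.\<close>

lemma wide_fork_fork:
  assumes "wide m (Suc k) t"
  shows "wide m (Suc (Suc k)) (fork l (fork l' t))"
  unfolding wide_def
proof (intro allI impI)
  fix w :: nat and \<tau> :: "nat \<Rightarrow> nat"
  assume w: "0 < w" and fibres: "\<forall>i. card {v \<in> places (fork l (fork l' t)) w. \<tau> v = i} \<le> m"
  define a b where "a = 2 * w * 2 ^ l" and "b = Suc (2 * w) * 2 ^ l"
  have ab: "desc a \<subseteq> desc (2 * w)" "desc b \<subseteq> desc (Suc (2 * w))" "0 < a"
    using w unfolding a_def b_def by (simp_all only: desc_mult_power_subset) simp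
  have sub: "places (fork l' t) a \<subseteq> places (fork l (fork l' t)) w"
    "places (fork l' t) b \<subseteq> places (fork l (fork l' t)) w"
    unfolding a_def b_def by (rule places_fork)+
  let ?w1 = "2 * a * 2 ^ l'" and ?w2 = "Suc (2 * a) * 2 ^ l'" and ?w3 = "2 * b * 2 ^ l'"
  have d: "desc ?w1 \<subseteq> desc (2 * a)" "desc ?w2 \<subseteq> desc (Suc (2 * a))" "desc ?w3 \<subseteq> desc (2 * b)"
    by (rule desc_mult_power_subset)+
  have d': "desc (2 * a) \<subseteq> desc a" "desc (Suc (2 * a)) \<subseteq> desc a" "desc (2 * b) \<subseteq> desc b"
    by (rule desc_subset, simp)+
  show "\<exists>s. Suc (Suc k) \<le> card (cut \<tau> s (places (fork l (fork l' t)) w) w)"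
  proof (rule wide_Suc[OF assms w _ _ _ _ _ _ fibres])
    show "places t ?w1 \<subseteq> places (fork l (fork l' t)) w"
      "places t ?w2 \<subseteq> places (fork l (fork l' t)) w"
      "places t ?w3 \<subseteq> places (fork l (fork l' t)) w"
      using places_fork[of t a l'] places_fork[of t b l'] sub by auto
    show "desc ?w1 \<inter> desc ?w2 = {}"
      using d desc_children_disjoint[OF \<open>0 < a\<close>] by auto
    show "desc ?w1 \<inter> desc ?w3 = {}" "desc ?w2 \<inter> desc ?w3 = {}"
      using d d' ab(1,2) desc_children_disjoint[OF w] by (blast dest: subsetD)+
  qed
qed

text \<open>More than \<open>m\<close> vertices cannot share one arrival time, so some vertex is
  separated in time from the root, and the path between the two crosses the threshold.\<close>

lemma wide_one:
  assumes "\<And>w. 0 < w \<Longrightarrow> m < card (places t w)"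
  shows "wide m 1 t"
  unfolding wide_def
proof (intro allI impI)
  fix w :: nat and \<tau> :: "nat \<Rightarrow> nat"
  assume w: "0 < w" and fibres: "\<forall>i. card {v \<in> places t w. \<tau> v = i} \<le> m"
  have "\<exists>x \<in> places t w. \<tau> x \<noteq> \<tau> w"
  proof (rule ccontr)
    assume "\<not> ?thesis"
    then have "{v \<in> places t w. \<tau> v = \<tau> w} = places t w" by blast
    then show False using assms[OF w] fibres[rule_format, of "\<tau> w"] by simp
  qed
  then obtain x where x: "x \<in> places t w" "\<tau> x \<noteq> \<tau> w" by blast
  \<comment> \<open>Early means strictly before the threshold, so the later of the two times
    separates them.\<close>
  then have "(\<tau> x < max (\<tau> x) (\<tau> w)) \<noteq> (\<tau> w < max (\<tau> x) (\<tau> w))" by (simp add: max_def)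
  from cut_between_root[OF w x(1) this] have "cut \<tau> (max (\<tau> x) (\<tau> w)) (places t w) w \<noteq> {}" by blast
  moreover have "finite (cut \<tau> (max (\<tau> x) (\<tau> w)) (places t w) w)" by (auto simp: cut_def)
  ultimately show "\<exists>s. 1 \<le> card (cut \<tau> s (places t w) w)"
    by (auto simp: Suc_le_eq card_gt_0_iff)
qed

lemma card_places_fork:
  assumes "0 < w"
  shows "card (places t (2 * w * 2 ^ l)) < card (places (fork l t) w)"
proof (rule psubset_card_mono)
  have "w \<notin> places t (2 * w * 2 ^ l)"
  proof
    assume "w \<in> places t (2 * w * 2 ^ l)"
    then have "w \<in> desc (2 * w)"
      using places_subset_desc[of t "2 * w * 2 ^ l"] desc_mult_power_subset[of "2 * w" l] by auto
    then show False using desc_ge assms by fastforce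
  qed
  then show "places t (2 * w * 2 ^ l) \<subset> places (fork l t) w"
    using places_fork(1)[of t w l] by auto
qed simp

subsection \<open>Pathwidth and linear clique-width\<close>

lemma card_le_mult_fibres:
  assumes "finite A" "\<And>a. a \<in> A \<Longrightarrow> f a < (k::nat)" "\<And>c. card {a \<in> A. f a = c} \<le> d"
  shows "card A \<le> d * k"
proof -
  have "A = (\<Union>c<k. {a \<in> A. f a = c})" using assms(2) by auto
  then have "card A = card (\<Union>c<k. {a \<in> A. f a = c})" by (rule arg_cong)
  also have "\<dots> \<le> (\<Sum>c<k. card {a \<in> A. f a = c})" by (rule card_UN_le) simp
  also have "\<dots> \<le> (\<Sum>c<k. d)" by (intro sum_mono assms(3))
  finally show ?thesis by (simp add: mult.commute)
qed

text \<open>Every cut edge has one early end, which lies in \<open>E\<close>. A vertex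
  \<open>u\<close> meets at most three edges, with lower ends \<open>u\<close>, \<open>2 * u\<close>
  and \<open>Suc (2 * u)\<close>.\<close>

lemma card_cut_le:
  assumes "finite E"
    and early: "\<And>u v. \<lbrakk>(u, v) \<in> parcs (heap_graph (places t w)); \<tau> u < s; s \<le> \<tau> v\<rbrakk> \<Longrightarrow> u \<in> E"
  shows "card (cut \<tau> s (places t w) w) \<le> 3 * card E"
proof -
  have "cut \<tau> s (places t w) w \<subseteq> (\<Union>u \<in> E. {u, 2 * u, Suc (2 * u)})"
  proof
    fix v assume "v \<in> cut \<tau> s (places t w) w"
    then have v: "v \<in> places t w" "v \<noteq> w" "(\<tau> v < s) \<noteq> (\<tau> (v div 2) < s)" by (auto simp: cut_def)
    then have "v div 2 \<in> places t w" by (intro half_in_places)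
    with v early[of v "v div 2"] early[of "v div 2" v] have "v \<in> E \<or> v div 2 \<in> E"
      by (simp add: not_less) linarith
    moreover have "v = 2 * (v div 2) \<or> v = Suc (2 * (v div 2))" by presburger
    ultimately show "v \<in> (\<Union>u \<in> E. {u, 2 * u, Suc (2 * u)})" by blast
  qed
  then have "card (cut \<tau> s (places t w) w) \<le> card (\<Union>u \<in> E. {u, 2 * u, Suc (2 * u)})"
    by (rule card_mono[rotated]) (use assms in auto)
  also have "\<dots> \<le> (\<Sum>u \<in> E. card {u, 2 * u, Suc (2 * u)})"
    using assms(1) by (rule card_UN_le)
  also have "\<dots> \<le> (\<Sum>u \<in> E. 3)" by (intro sum_mono) (auto simp: card_insert_if)
  finally show ?thesis by simp
qed

text \<open>Order the vertices by the first bag containing them. If all bags had at most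
  \<open>m\<close> elements, so would the fibres; by convexity the early end of an edge cut at time
  \<open>s\<close> still lies in bag \<open>s\<close>, so cuts would have at most
  \<open>3 * m\<close> edges.\<close>

lemma wide_no_path_decomposition:
  assumes wide: "wide m (Suc (3 * m)) t" and w: "0 < w"
    and pd: "path_decomposition (heap_graph (places t w)) Xs"
  shows "\<exists>X \<in> set Xs. m < card X"
proof (rule ccontr)
  assume "\<not> ?thesis"
  then have small: "card X \<le> m" if "X \<in> set Xs" for X using that by (simp add: not_less)
  let ?V = "places t w"
  define \<tau> where "\<tau> v = (LEAST i. i < length Xs \<and> v \<in> Xs ! i)" for v
  note pd' = pd[unfolded path_decomposition_def]
  from pd' have cover: "\<Union> (set Xs) = ?V" by simp
  have edges: "\<exists>X \<in> set Xs. u \<in> X \<and> v \<in> X" if "(u, v) \<in> parcs (heap_graph ?V)" for u v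
    using pd'[THEN conjunct2, THEN conjunct2, THEN conjunct1] that by blast
  have convex: "Xs ! i \<inter> Xs ! k \<subseteq> Xs ! j" if "i \<le> j" "j \<le> k" "k < length Xs" for i j k
    using pd'[THEN conjunct2, THEN conjunct2, THEN conjunct2] that by simp
  have fin: "finite X" if "X \<in> set Xs" for X
    by (rule finite_subset[OF _ finite_places[of t w]]) (use Sup_upper[OF that] cover in simp)
  have \<tau>: "\<tau> v < length Xs \<and> v \<in> Xs ! \<tau> v" if "v \<in> ?V" for v
  proof -
    have "v \<in> \<Union> (set Xs)" using that by (simp only: cover)
    then obtain X where "X \<in> set Xs" "v \<in> X" by (rule UnionE)
    then have "\<exists>i. i < length Xs \<and> v \<in> Xs ! i" by (metis in_set_conv_nth)
    then show ?thesis unfolding \<tau>_def by (rule LeastI_ex)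
  qed
  have \<tau>_le: "\<tau> v \<le> i" if "i < length Xs" "v \<in> Xs ! i" for v i
    unfolding \<tau>_def using that by (intro Least_le conjI)
  have "\<forall>i. card {v \<in> ?V. \<tau> v = i} \<le> m"
  proof
    fix i
    show "card {v \<in> ?V. \<tau> v = i} \<le> m"
    proof (cases "i < length Xs")
      case True
      have "{v \<in> ?V. \<tau> v = i} \<subseteq> Xs ! i" using \<tau> by blast
      then have "card {v \<in> ?V. \<tau> v = i} \<le> card (Xs ! i)"
        by (rule card_mono[rotated]) (simp add: fin True)
      then show ?thesis using small[of "Xs ! i"] True by simp
    next
      case False
      then have "{v \<in> ?V. \<tau> v = i} = {}" using \<tau> by blast
      then show ?thesis by (simp only: card.empty zero_le)
    qed
  qed
  with wide w obtain s where s: "Suc (3 * m) \<le> card (cut \<tau> s ?V w)"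
    unfolding wide_def by blast
  \<comment> \<open>When all bags have been passed no vertex is late, so the empty set
    serves.\<close>
  define E where "E = (if s < length Xs then Xs ! s else {})"
  have E: "card E \<le> m" "finite E"
    using small[OF nth_mem[of s]] fin[OF nth_mem[of s]] unfolding E_def by simp_all
  have "card (cut \<tau> s ?V w) \<le> 3 * card E"
  proof (rule card_cut_le[OF E(2)])
    fix u v assume uv: "(u, v) \<in> parcs (heap_graph ?V)" "\<tau> u < s" "s \<le> \<tau> v"
    obtain X where X: "X \<in> set Xs" "u \<in> X" "v \<in> X" using edges[OF uv(1)] by blast
    obtain i where "i < length Xs" "X = Xs ! i" using X(1) by (metis in_set_conv_nth)
    with X have i: "i < length Xs" "u \<in> Xs ! i" "v \<in> Xs ! i" by simp_all
    have "s \<le> i" using \<tau>_le[OF i(1,3)] uv(3) by (rule le_trans[rotated])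
    then have "Xs ! \<tau> u \<inter> Xs ! i \<subseteq> Xs ! s" using convex[of "\<tau> u" s i] uv(2) i(1) by simp
    moreover have "u \<in> Xs ! \<tau> u" using \<tau>[of u] uv(1) by simp
    ultimately have "u \<in> Xs ! s" using i(2) by blast
    then show "u \<in> E" using i(1) \<open>s \<le> i\<close> by (simp add: E_def)
  qed
  with s E show False by linarith
qed

lemma wide_imp_pathwidth:
  assumes "wide m (Suc (3 * m)) t" "0 < w"
  shows "m \<le> pathwidth (heap_graph (places t w))"
proof -
  let ?G = "heap_graph (places t w)"
  \<comment> \<open>A single bag with all vertices shows that the minimum in
    \<open>pathwidth\<close> is attained.\<close>
  have "path_decomposition ?G [places t w]"
    by (auto simp: path_decomposition_def)
  then have "\<exists>b Xs. path_decomposition ?G Xs \<and> decomposition_width Xs = b" by blast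
  then have "\<exists>Xs. path_decomposition ?G Xs \<and> decomposition_width Xs = pathwidth ?G"
    unfolding pathwidth_def by (rule LeastI_ex)
  then obtain Xs where Xs: "path_decomposition ?G Xs" "decomposition_width Xs = pathwidth ?G"
    by blast
  obtain X where X: "X \<in> set Xs" "m < card X"
    using wide_no_path_decomposition[OF assms Xs(1)] by blast
  have "card X \<le> Max (card ` set Xs)" using X by simp
  then show ?thesis using X(2) Xs(2) unfolding decomposition_width_def by linarith
qed

text \<open>
  If two vertices of an initial segment carry the same label when the segment is complete, every
  later operation treats them alike; \<open>lab\<close> is the labelling at that moment, and \<open>l\<close> the current one.
\<close>

definition treated_alike ::
  "nat \<Rightarrow> 'a pair_pre_digraph \<Rightarrow> ('a \<Rightarrow> nat) \<Rightarrow> ('a \<Rightarrow> nat) \<Rightarrow> nat \<Rightarrow> ('a \<Rightarrow> nat) \<Rightarrow> bool" where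
  "treated_alike k G l \<tau> s lab \<longleftrightarrow> (\<forall>u \<in> pverts G. \<tau> u < s \<longrightarrow> lab u < k \<and>
     (\<forall>u' \<in> pverts G. \<tau> u' < s \<longrightarrow> lab u = lab u' \<longrightarrow> l u = l u' \<and>
       (\<forall>x \<in> pverts G. s \<le> \<tau> x \<longrightarrow> (u, x) \<in> parcs G \<longrightarrow> (u', x) \<in> parcs G)))"

lemma treated_alikeI:
  assumes "\<And>u. \<lbrakk>u \<in> pverts G; \<tau> u < s\<rbrakk> \<Longrightarrow> lab u < k"
    and "\<And>u u'. \<lbrakk>u \<in> pverts G; \<tau> u < s; u' \<in> pverts G; \<tau> u' < s; lab u = lab u'\<rbrakk> \<Longrightarrow> l u = l u'"
    and "\<And>u u' x. \<lbrakk>u \<in> pverts G; \<tau> u < s; u' \<in> pverts G; \<tau> u' < s; lab u = lab u';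
      x \<in> pverts G; s \<le> \<tau> x; (u, x) \<in> parcs G\<rbrakk> \<Longrightarrow> (u', x) \<in> parcs G"
  shows "treated_alike k G l \<tau> s lab"
  unfolding treated_alike_def by (intro ballI impI conjI; rule assms)

lemma treated_alikeD:
  assumes "treated_alike k G l \<tau> s lab" "u \<in> pverts G" "\<tau> u < s"
  shows "lab u < k"
    and "\<lbrakk>u' \<in> pverts G; \<tau> u' < s; lab u = lab u'\<rbrakk> \<Longrightarrow> l u = l u'"
    and "\<lbrakk>u' \<in> pverts G; \<tau> u' < s; lab u = lab u'; x \<in> pverts G; s \<le> \<tau> x; (u, x) \<in> parcs G\<rbrakk>
      \<Longrightarrow> (u', x) \<in> parcs G"
proof -
  note alike = bspec[OF assms(1)[unfolded treated_alike_def] assms(2), THEN mp, OF assms(3)]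
  show "lab u < k" using alike by (rule conjunct1)
  assume u': "u' \<in> pverts G" "\<tau> u' < s" "lab u = lab u'"
  note alike' = alike[THEN conjunct2, THEN bspec, OF u'(1), THEN mp, OF u'(2), THEN mp, OF u'(3)]
  show "l u = l u'" using alike' by (rule conjunct1)
  show "(u', x) \<in> parcs G" if "x \<in> pverts G" "s \<le> \<tau> x" "(u, x) \<in> parcs G"
    using alike'[THEN conjunct2] that by blast
qed

definition alike_order :: "nat \<Rightarrow> 'a pair_pre_digraph \<Rightarrow> ('a \<Rightarrow> nat) \<Rightarrow> ('a \<Rightarrow> nat) \<Rightarrow> bool" where
  "alike_order k G l \<tau> \<longleftrightarrow> inj_on \<tau> (pverts G) \<and> (\<forall>s. \<exists>lab. treated_alike k G l \<tau> s lab)"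

text \<open>\<open>\<tau>\<close> is the order of creation. Joins and relabellings look only at
  current labels, which agree on vertices treated alike; only the creation of a vertex needs a case
  distinction on \<open>s\<close>.\<close>

lemma linear_expr_order:
  assumes "linear_expr k G l"
  shows "finite (pverts G) \<and> parcs G \<subseteq> pverts G \<times> pverts G \<and> (\<forall>v \<in> pverts G. l v < k) \<and>
    (\<exists>\<tau>. alike_order k G l \<tau>)"
  using assms
proof (induction rule: linear_expr.induct)
  case (empty l)
  then show ?case by (auto simp: treated_alike_def alike_order_def)
next
  case (new_vertex G l v i)
  then obtain \<tau> where fin: "finite (pverts G)" and wf: "parcs G \<subseteq> pverts G \<times> pverts G"
    and l: "\<forall>v \<in> pverts G. l v < k" and inj: "inj_on \<tau> (pverts G)"
    and \<tau>: "\<And>s. \<exists>lab. treated_alike k G l \<tau> s lab" unfolding alike_order_def by blast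
  \<comment> \<open>A time later than all used so far; the inserted 0 covers the empty
    graph.\<close>
  define n where "n = Suc (Max (insert 0 (\<tau> ` pverts G)))"
  have n: "\<tau> u < n" if "u \<in> pverts G" for u
    using fin that unfolding n_def less_Suc_eq_le by (intro Max_ge) auto
  let ?G = "\<lparr> pverts = insert v (pverts G), parcs = parcs G \<rparr>"
  have "inj_on (\<tau>(v := n)) (pverts ?G)"
    using inj n new_vertex by (fastforce simp: inj_on_def)
  moreover have "\<exists>lab. treated_alike k ?G (l(v := i)) (\<tau>(v := n)) s lab" for s
  proof (cases "s \<le> n")
    case True
    \<comment> \<open>The new vertex counts as late and has no edges yet, so the old labelling of
      the initial segment still serves.\<close>
    obtain lab where lab: "treated_alike k G l \<tau> s lab" using \<tau> by blast
    have old: "u \<in> pverts G \<and> \<tau> u < s \<and> u \<noteq> v"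
      if "u \<in> pverts ?G" "(\<tau>(v := n)) u < s" for u
      using that True by (auto split: if_splits)
    have "treated_alike k ?G (l(v := i)) (\<tau>(v := n)) s lab"
    proof (rule treated_alikeI)
      fix u u'
      assume u: "u \<in> pverts ?G" "(\<tau>(v := n)) u < s"
      then show "lab u < k" using old treated_alikeD(1)[OF lab] by blast
      assume u': "u' \<in> pverts ?G" "(\<tau>(v := n)) u' < s" and eq: "lab u = lab u'"
      show "(l(v := i)) u = (l(v := i)) u'"
        using old[OF u] old[OF u'] treated_alikeD(2)[OF lab _ _ _ _ eq] by simp
      fix x
      assume x: "s \<le> (\<tau>(v := n)) x" "(u, x) \<in> parcs ?G"
      then have "x \<in> pverts G" using wf by auto
      moreover from this have "x \<noteq> v" using new_vertex.hyps by blast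
      ultimately show "(u', x) \<in> parcs ?G"
        using old[OF u] old[OF u'] treated_alikeD(3)[OF lab _ _ _ _ eq, of x] x by simp
    qed
    then show ?thesis by (rule exI[of _ lab])
  next
    case False
    \<comment> \<open>All vertices are early, so there are no late neighbours to compare, and the
      current labelling itself serves.\<close>
    have "treated_alike k ?G (l(v := i)) (\<tau>(v := n)) s (l(v := i))"
    proof (rule treated_alikeI)
      show "(l(v := i)) u < k" if "u \<in> pverts ?G" for u
        using that l new_vertex.hyps by auto
      show "(u', x) \<in> parcs ?G" if "x \<in> pverts ?G" "s \<le> (\<tau>(v := n)) x" for u' x
        using that False n[of x] by (auto split: if_splits)
    qed
    then show ?thesis by (rule exI[of _ "l(v := i)"])
  qed
  ultimately have "alike_order k ?G (l(v := i)) (\<tau>(v := n))"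
    unfolding alike_order_def by (intro conjI allI)
  then have "\<exists>\<tau>. alike_order k ?G (l(v := i)) \<tau>" by blast
  moreover have "finite (pverts ?G)" "parcs ?G \<subseteq> pverts ?G \<times> pverts ?G"
    "\<forall>x \<in> pverts ?G. (l(v := i)) x < k"
    using fin wf l new_vertex.hyps by auto
  ultimately show ?case by (intro conjI)
next
  case (join G l i j)
  then obtain \<tau> where inj: "inj_on \<tau> (pverts G)"
    and \<tau>: "\<And>s. \<exists>lab. treated_alike k G l \<tau> s lab" unfolding alike_order_def by blast
  let ?G = "\<lparr> pverts = pverts G, parcs = parcs G \<union> {(u, v). u \<in> pverts G \<and> v \<in> pverts G \<and>
    (l u = i \<and> l v = j \<or> l u = j \<and> l v = i)} \<rparr>"
  have "\<exists>lab. treated_alike k ?G l \<tau> s lab" for s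
  proof -
    obtain lab where lab: "treated_alike k G l \<tau> s lab" using \<tau> by blast
    have "treated_alike k ?G l \<tau> s lab"
    proof (rule treated_alikeI)
      fix u u'
      assume u: "u \<in> pverts ?G" "\<tau> u < s"
      then show "lab u < k" using treated_alikeD(1)[OF lab] by simp
      assume u': "u' \<in> pverts ?G" "\<tau> u' < s" and eq: "lab u = lab u'"
      show l: "l u = l u'" using u u' treated_alikeD(2)[OF lab _ _ _ _ eq] by simp
      fix x
      assume "x \<in> pverts ?G" "s \<le> \<tau> x" "(u, x) \<in> parcs ?G"
      then show "(u', x) \<in> parcs ?G"
        using l u u' treated_alikeD(3)[OF lab _ _ _ _ eq, of x] by auto
    qed
    then show ?thesis by (rule exI[of _ lab])
  qed
  with inj have "alike_order k ?G l \<tau>"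
    unfolding alike_order_def pair_pre_digraph.simps by (intro conjI allI)
  then have "\<exists>\<tau>. alike_order k ?G l \<tau>" by blast
  moreover have "finite (pverts ?G)" "parcs ?G \<subseteq> pverts ?G \<times> pverts ?G"
    "\<forall>x \<in> pverts ?G. l x < k"
    using join by auto
  ultimately show ?case by (intro conjI)
next
  case (relabel G l i j)
  then obtain \<tau> where inj: "inj_on \<tau> (pverts G)"
    and \<tau>: "\<And>s. \<exists>lab. treated_alike k G l \<tau> s lab" unfolding alike_order_def by blast
  have "\<exists>lab. treated_alike k G (\<lambda>v. if l v = i then j else l v) \<tau> s lab" for s
  proof -
    obtain lab where lab: "treated_alike k G l \<tau> s lab" using \<tau> by blast
    have "treated_alike k G (\<lambda>v. if l v = i then j else l v) \<tau> s lab"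
    proof (rule treated_alikeI)
      fix u u'
      assume u: "u \<in> pverts G" "\<tau> u < s"
      then show "lab u < k" by (rule treated_alikeD(1)[OF lab])
      assume u': "u' \<in> pverts G" "\<tau> u' < s" and eq: "lab u = lab u'"
      show "(if l u = i then j else l u) = (if l u' = i then j else l u')"
        using treated_alikeD(2)[OF lab u u' eq] by simp
      show "(u', x) \<in> parcs G" if "x \<in> pverts G" "s \<le> \<tau> x" "(u, x) \<in> parcs G" for x
        by (rule treated_alikeD(3)[OF lab u u' eq that])
    qed
    then show ?thesis by (rule exI[of _ lab])
  qed
  with inj have "alike_order k G (\<lambda>v. if l v = i then j else l v) \<tau>"
    unfolding alike_order_def by (intro conjI allI)
  then have "\<exists>\<tau>. alike_order k G (\<lambda>v. if l v = i then j else l v) \<tau>" by blast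
  moreover have "\<forall>v \<in> pverts G. (if l v = i then j else l v) < k" using relabel by simp
  ultimately show ?case using relabel.IH by (intro conjI) blast+
qed

text \<open>Let \<open>E\<close> be the early vertices with a late neighbour. Those with equal
  labels share a late neighbour, so by the degree bound each label occurs at most three times in
  \<open>E\<close>. Hence \<open>E\<close> has at most \<open>3 * k\<close> vertices and the cut at
  most \<open>9 * k\<close> edges.\<close>

lemma wide_imp_linear_expr:
  assumes wide: "wide 1 (Suc (9 * k)) t" and w: "0 < w"
  shows "\<not> linear_expr k (heap_graph (places t w)) l"
proof
  let ?V = "places t w"
  let ?G = "heap_graph ?V"
  assume "linear_expr k ?G l"
  from linear_expr_order[OF this] obtain \<tau> where inj: "inj_on \<tau> ?V"
    and \<tau>: "\<And>s. \<exists>lab. treated_alike k ?G l \<tau> s lab"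
    unfolding alike_order_def heap_graph_simps(1) by blast
  have "card {v \<in> ?V. \<tau> v = i} \<le> 1" for i
    unfolding One_nat_def by (rule card_le_Suc0_iff_eq[THEN iffD2])
      (use inj in \<open>auto simp: inj_on_def\<close>)
  with wide w obtain s where s: "Suc (9 * k) \<le> card (cut \<tau> s ?V w)"
    unfolding wide_def by blast
  obtain lab where lab: "treated_alike k ?G l \<tau> s lab" using \<tau> by blast
  define E where "E = {u \<in> ?V. \<tau> u < s \<and> (\<exists>x \<in> ?V. s \<le> \<tau> x \<and> (u, x) \<in> parcs ?G)}"
  have "finite E" by (auto simp: E_def)
  have "card E \<le> 3 * k"
  proof (rule card_le_mult_fibres[OF \<open>finite E\<close>])
    show "lab u < k" if "u \<in> E" for u
      using that lab by (auto simp: E_def treated_alike_def)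
    show "card {u \<in> E. lab u = c} \<le> 3" for c
    proof (cases "{u \<in> E. lab u = c} = {}")
      case False
      then obtain u x where ux: "u \<in> E" "lab u = c" "x \<in> ?V" "s \<le> \<tau> x" "(u, x) \<in> parcs ?G"
        by (auto simp: E_def)
      have "{u \<in> E. lab u = c} \<subseteq> {u'. (x, u') \<in> parcs ?G}"
      proof
        fix u' assume "u' \<in> {u \<in> E. lab u = c}"
        then have "(u', x) \<in> parcs ?G"
          using ux lab unfolding treated_alike_def E_def heap_graph_simps(1) by blast
        then show "u' \<in> {u'. (x, u') \<in> parcs ?G}" by auto
      qed
      moreover have "finite {u'. (x, u') \<in> parcs ?G}"
        using heap_graph_neighbours by (rule finite_subset) simp
      ultimately show ?thesis
        using card_heap_graph_neighbours card_mono le_trans by meson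
    next
      case True
      then show ?thesis by (metis card.empty zero_le)
    qed
  qed
  moreover have "card (cut \<tau> s ?V w) \<le> 3 * card E"
    by (rule card_cut_le[OF \<open>finite E\<close>]) (auto simp: E_def)
  ultimately show False using s by linarith
qed

text \<open>Vertices are numbers, so each can keep itself as its label, and a join then adds just
  one edge. This shows that the minimum in \<open>linear_cliquewidth\<close> is attained.\<close>

lemma linear_expr_exists:
  assumes "pair_graph G" "\<forall>v \<in> pverts G. v < k"
  shows "linear_expr k G id"
proof -
  interpret pair_graph G by fact
  have vertices: "linear_expr k \<lparr> pverts = U, parcs = {} \<rparr> id"
    if "finite U" "U \<subseteq> pverts G" for U
    using that
  proof (induction U rule: finite_induct)
    case empty
    show ?case by (rule linear_expr.empty)
  next
    case (insert v U)
    then have "linear_expr k \<lparr> pverts = insert v U, parcs = {} \<rparr> (id(v := v))"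
      using linear_expr.new_vertex[of k "\<lparr> pverts = U, parcs = {} \<rparr>" id v v] assms(2)
      by (simp del: id_apply fun_upd_triv)
    moreover have "id(v := v) = id" by auto
    ultimately show ?case by (simp only:)
  qed
  have "linear_expr k \<lparr> pverts = pverts G, parcs = A \<union> A\<inverse> \<rparr> id" if "finite A" "A \<subseteq> parcs G" for A
    using that
  proof (induction A rule: finite_induct)
    case empty
    show ?case using vertices[OF pair_finite_verts subset_refl]
      by (simp only: Un_empty_left converse_empty)
  next
    case (insert e A)
    obtain u v where e: "e = (u, v)" by fastforce
    then have "(u, v) \<in> parcs G" using insert.prems by simp
    then have uv: "u \<in> pverts G" "v \<in> pverts G" "u \<noteq> v"
      using in_arcsD1 in_arcsD2 pair_no_loops[of "(u, v)"] by auto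
    have "linear_expr k \<lparr> pverts = pverts G, parcs = (A \<union> A\<inverse>) \<union>
        {(x, y). x \<in> pverts G \<and> y \<in> pverts G \<and> (id x = u \<and> id y = v \<or> id x = v \<and> id y = u)} \<rparr> id"
      using linear_expr.join[of k "\<lparr> pverts = pverts G, parcs = A \<union> A\<inverse> \<rparr>" id u v]
        insert uv assms(2) unfolding pair_pre_digraph.simps by blast
    moreover have "(A \<union> A\<inverse>) \<union>
        {(x, y). x \<in> pverts G \<and> y \<in> pverts G \<and> (id x = u \<and> id y = v \<or> id x = v \<and> id y = u)}
        = insert e A \<union> (insert e A)\<inverse>"
      using uv by (auto simp: e)
    ultimately show ?case by (simp only:)
  qed
  from this[of "parcs G"] have "linear_expr k \<lparr> pverts = pverts G, parcs = parcs G \<union> (parcs G)\<inverse> \<rparr> id"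
    using pair_finite_arcs by blast
  moreover have "parcs G \<union> (parcs G)\<inverse> = parcs G"
    using pair_sym_arcs by (auto simp: symmetric_def sym_def)
  moreover have "\<lparr> pverts = pverts G, parcs = parcs G \<rparr> = G" by simp
  ultimately show ?thesis by (simp only:)
qed

lemma wide_imp_linear_cliquewidth:
  assumes "wide 1 (Suc (9 * k)) t" "0 < w"
  shows "k < linear_cliquewidth (heap_graph (places t w))"
proof (rule ccontr)
  let ?G = "heap_graph (places t w)"
  assume "\<not> ?thesis"
  then have le: "linear_cliquewidth ?G \<le> k" by simp
  have "linear_expr (Suc (Max (places t w))) ?G id"
    by (rule linear_expr_exists[OF pair_graph_heap_graph])
      (auto simp: zero_notin_places[OF assms(2)] less_Suc_eq_le)
  then have "\<exists>k l. linear_expr k ?G l" by blast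
  then have "\<exists>l. linear_expr (linear_cliquewidth ?G) ?G l"
    unfolding linear_cliquewidth_def by (rule LeastI_ex)
  \<comment> \<open>A wide shape is also wide for any smaller demand on the cut.\<close>
  moreover have "wide 1 (Suc (9 * linear_cliquewidth ?G)) t"
    using assms(1) le unfolding wide_def by (meson Suc_le_mono le_trans mult_le_mono2)
  ultimately show False using wide_imp_linear_expr assms(2) by blast
qed

subsection \<open>Searching trees with long tails\<close>

definition spread :: "nat \<Rightarrow> 'a pair_pre_digraph \<Rightarrow> 'a set \<Rightarrow> 'a set \<Rightarrow> 'a set \<Rightarrow> 'a set" where
  "spread r G C C' A = {u \<in> pverts G - C'. \<exists>a \<in> A.
     reach_within r (with_proj G \<restriction> (pverts G - (C \<inter> C'))) a u}"

text \<open>Unlike \<open>robber_area\<close>, this starts from an arbitrary area and position, so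
  that the phases of a search can be composed.\<close>

primrec run :: "nat \<Rightarrow> 'a pair_pre_digraph \<Rightarrow> 'a set \<Rightarrow> 'a set \<Rightarrow> 'a set list \<Rightarrow> 'a set" where
  "run r G A C [] = A"
| "run r G A C (C' # Cs) = run r G (spread r G C C' A) C' Cs"

lemma run_append: "run r G A C (Cs @ Ds) = run r G (run r G A C Cs) (last (C # Cs)) Ds"
  by (induction Cs arbitrary: A C) auto

lemma robber_area_eq_run:
  "i \<le> length Cs \<Longrightarrow> robber_area r G (C # Cs) i = run r G (pverts G - C) C (take i Cs)"
proof (induction i)
  case (Suc i)
  have "last (C # take i Cs) = (C # Cs) ! i"
    using Suc.prems by (cases i) (auto simp: last_conv_nth)
  then show ?case
    using Suc by (simp add: take_Suc_conv_app_nth run_append spread_def)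
qed simp

text \<open>A strategy has to stay inside the graph. Trimming its positions does no harm, which
  avoids checking where \<open>search\<close> places the cops.\<close>

lemma robber_area_Int_verts:
  "i < length Cs \<Longrightarrow>
   robber_area r G (map (\<lambda>C. C \<inter> pverts G) Cs) i = robber_area r G Cs i"
proof (induction i)
  case 0
  then show ?case by auto
next
  case (Suc i)
  have *: "pverts G - (Cs ! i \<inter> pverts G) \<inter> (Cs ! Suc i \<inter> pverts G) = pverts G - Cs ! i \<inter> Cs ! Suc i"
    "pverts G - Cs ! Suc i \<inter> pverts G = pverts G - Cs ! Suc i"
    by auto
  have IH: "robber_area r G (map (\<lambda>C. C \<inter> pverts G) Cs) i = robber_area r G Cs i"
    using Suc by simp
  have nth: "map (\<lambda>C. C \<inter> pverts G) Cs ! i = Cs ! i \<inter> pverts G"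
    "map (\<lambda>C. C \<inter> pverts G) Cs ! Suc i = Cs ! Suc i \<inter> pverts G"
    using Suc.prems by simp_all
  show ?case unfolding robber_area.simps nth * IH ..
qed

lemma arcs_ends_induce_subgraph:
  "(x, y) \<in> arcs_ends (with_proj G \<restriction> S) \<longleftrightarrow> (x, y) \<in> parcs G \<and> x \<in> S \<and> y \<in> S"
  by (auto simp: arcs_ends_def arc_to_ends_def induce_subgraph_def)

text \<open>Trace the walk back from \<open>u\<close>: each step lowers the index of
  \<open>K\<close> by one, and antitonicity absorbs a walk shorter than \<open>r\<close>.\<close>

lemma reach_within_backwards:
  assumes "reach_within r H a u" and "u \<in> K r"
    and step: "\<And>n x y. \<lbrakk>(x, y) \<in> arcs_ends H; y \<in> K (Suc n)\<rbrakk> \<Longrightarrow> x \<in> K n"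
    and "antimono K"
  shows "a \<in> K 0"
proof -
  obtain p where p: "vwalk p H" "hd p = a" "last p = u" "vwalk_length p \<le> r"
    using assms(1) by (auto simp: reach_within_def vpath_def)
  have "hd p \<in> K n" if "last p \<in> K (n + vwalk_length p)" for n
    using p(1) that
  proof (induction p arbitrary: n rule: vwalk_induct)
    case (Cons x y p)
    have "y \<in> K (Suc n)" using Cons.IH[of "Suc n"] Cons.prems by simp
    then show ?case using step Cons.hyps by simp
  qed simp
  moreover have "u \<in> K (0 + vwalk_length p)"
    using assms(2) antimonoD[OF \<open>antimono K\<close> p(4)] by auto
  ultimately show ?thesis using p by blast
qed

text \<open>A constant family \<open>K\<close> describes territory guarded by cops; a shrinking one
  describes unguarded territory that is lost at the speed of the robber.\<close>

lemma spread_disjoint: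
  assumes "A \<inter> K 0 = {}" "antimono K"
    and "\<And>n x y. \<lbrakk>(x, y) \<in> parcs G; x \<notin> C \<inter> C'; y \<notin> C \<inter> C'; y \<in> K (Suc n)\<rbrakk> \<Longrightarrow> x \<in> K n"
  shows "spread r G C C' A \<inter> K r = {}"
proof (rule Int_emptyI)
  fix u assume "u \<in> spread r G C C' A" "u \<in> K r"
  then obtain a where "a \<in> A"
    and "reach_within r (with_proj G \<restriction> (pverts G - (C \<inter> C'))) a u" by (auto simp: spread_def)
  from this(2) \<open>u \<in> K r\<close> have "a \<in> K 0"
    by (rule reach_within_backwards) (use assms in \<open>auto simp: arcs_ends_induce_subgraph\<close>)
  with \<open>a \<in> A\<close> assms(1) show False by blast
qed

lemma spread_guarded:
  assumes "A \<inter> K = {}"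
    and "\<And>x y. \<lbrakk>(x, y) \<in> parcs G; x \<notin> C \<inter> C'; y \<notin> C \<inter> C'; y \<in> K\<rbrakk> \<Longrightarrow> x \<in> K"
  shows "spread r G C C' A \<inter> (K \<union> C') = {}"
proof -
  have "spread r G C C' A \<inter> (\<lambda>_. K) r = {}"
    by (rule spread_disjoint) (use assms in \<open>auto simp: antimono_def\<close>)
  then show ?thesis by (auto simp: spread_def)
qed

lemma spread_subset: "spread r G C C' A \<subseteq> pverts G"
  by (auto simp: spread_def)

section \<open>Recontamination below an unguarded vertex\<close>

definition deep :: "nat \<Rightarrow> nat \<Rightarrow> nat set" where
  "deep c n = {v. \<exists>j \<ge> n. v div 2 ^ j = c}"

lemma deep_0 [simp]: "deep c 0 = desc c"
  by (simp add: deep_def desc_def)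

lemma antimono_deep: "m \<le> n \<Longrightarrow> deep c n \<subseteq> deep c m"
  unfolding deep_def using le_trans by blast

lemma desc_subset_deep: "desc (c * 2 ^ n) \<subseteq> deep c n"
proof
  fix v assume "v \<in> desc (c * 2 ^ n)"
  then obtain j where "v div 2 ^ j = c * 2 ^ n" by (auto simp: desc_def)
  then have "v div 2 ^ (j + n) = c" by (simp add: power_add div_mult2_eq)
  then show "v \<in> deep c n" by (auto simp: deep_def intro: exI[of _ "j + n"])
qed

lemma deep_step:
  assumes "(x, y) \<in> parcs (heap_graph V)" "y \<in> deep c (Suc n)"
  shows "x \<in> deep c n"
proof -
  obtain j where j: "Suc n \<le> j" "y div 2 ^ j = c" using assms(2) by (auto simp: deep_def)
  from assms(1) consider "x = y div 2" | "y = x div 2" by auto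
  then show ?thesis
  proof cases
    case 1
    obtain i where "j = Suc i" using j(1) by (cases j) auto
    then have "n \<le> i" "x div 2 ^ i = c" using j 1 by (auto simp: div_mult2_eq)
    then show ?thesis by (auto simp: deep_def)
  next
    case 2
    then have "x div 2 ^ Suc j = c" using j by (simp add: div_mult2_eq)
    then show ?thesis using j(1) unfolding deep_def by (intro CollectI exI[of _ "Suc j"]) simp
  qed
qed

text \<open>A step changes the depth below \<open>c\<close> by at most one, and the only way in is
  through \<open>c\<close>. So, wherever the cops are, one round costs at most \<open>R\<close>
  levels of clear territory.\<close>

lemma spread_deep:
  assumes "A \<inter> deep c n = {}" "r \<le> R"
  shows "spread r (heap_graph V) C C' A \<inter> deep c (n + R) = {}"
proof -
  have "spread r (heap_graph V) C C' A \<inter> (\<lambda>i. deep c (n + i)) r = {}"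
  proof (rule spread_disjoint)
    show "A \<inter> deep c (n + 0) = {}" using assms by simp
    show "antimono (\<lambda>i. deep c (n + i))" by (intro antimonoI antimono_deep) simp
    show "x \<in> deep c (n + i)"
      if "(x, y) \<in> parcs (heap_graph V)" "y \<in> deep c (n + Suc i)" for i x y
      using deep_step that by simp
  qed
  moreover have "deep c (n + R) \<subseteq> deep c (n + r)" by (rule antimono_deep) (use assms in simp)
  ultimately show ?thesis by blast
qed

lemma run_deep:
  assumes "A \<inter> deep c n = {}" "r \<le> R"
  shows "run r (heap_graph V) A C Cs \<inter> deep c (n + R * length Cs) = {}"
  using assms(1)
proof (induction Cs arbitrary: A C n)
  case (Cons C' Cs)
  have "spread r (heap_graph V) C C' A \<inter> deep c (n + R) = {}"
    using spread_deep[OF Cons.prems assms(2)] .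
  from Cons.IH[OF this] show ?case by (simp add: add.assoc)
qed simp

section \<open>Sweeping upwards\<close>

definition below :: "nat set \<Rightarrow> nat set" where
  "below X = (\<Union>x \<in> X. desc x)"

text \<open>Each level takes two rounds: the halves are occupied while \<open>X\<close> is still
  held, and only then is \<open>X\<close> given up, so the frontier is never open.\<close>

primrec sweep_up :: "nat \<Rightarrow> nat set \<Rightarrow> nat set list" where
  "sweep_up 0 X = []"
| "sweep_up (Suc n) X =
     (X \<union> (\<lambda>v. v div 2) ` X) # (\<lambda>v. v div 2) ` X # sweep_up n ((\<lambda>v. v div 2) ` X)"

lemma length_sweep_up [simp]: "length (sweep_up n X) = 2 * n"
  by (induction n arbitrary: X) auto

lemma image_half_power:
  "(\<lambda>v. v div 2 ^ n) ` (\<lambda>v. v div 2) ` X = (\<lambda>v. v div 2 ^ Suc n) ` X" for X :: "nat set"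
  by (simp add: image_image div_mult2_eq)

lemma last_sweep_up: "last (X # sweep_up n X) = (\<lambda>v. v div 2 ^ n) ` X"
proof (induction n arbitrary: X)
  case (Suc n)
  have "last (X # sweep_up (Suc n) X) = last ((\<lambda>v. v div 2) ` X # sweep_up n ((\<lambda>v. v div 2) ` X))"
    by simp
  then show ?case unfolding Suc image_half_power .
qed simp

lemma small_sweep_up:
  assumes "finite X" "C \<in> set (sweep_up n X)"
  shows "finite C \<and> card C \<le> 2 * card X"
  using assms
proof (induction n arbitrary: X)
  case (Suc n)
  let ?H = "(\<lambda>v. v div 2) ` X"
  have half: "card ?H \<le> card X" using Suc.prems(1) by (rule card_image_le)
  then have union: "card (X \<union> ?H) \<le> 2 * card X"
    using card_Un_le[of X ?H] by linarith
  consider "C = X \<union> ?H" | "C = ?H" | "C \<in> set (sweep_up n ?H)" using Suc.prems(2) by auto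
  then show ?case using Suc.prems(1) half union Suc.IH[of ?H] by cases simp_all
qed simp

lemma below_arc:
  assumes "(x, y) \<in> parcs (heap_graph V)" "y \<in> below X" "x \<notin> below X"
  shows "y \<in> X \<and> x = y div 2"
proof -
  obtain z where z: "z \<in> X" "y \<in> desc z" "x \<notin> desc z" using assms by (auto simp: below_def)
  have "y \<noteq> x div 2" using z desc_of_half by blast
  then have "x = y div 2" using assms(1) by auto
  then show ?thesis using z half_in_desc[of y z] by auto
qed

text \<open>The second hypothesis says that moving up a level meets no unsearched branch: within
  \<open>V\<close>, only the new frontier itself is added to what was below the old one.\<close>

lemma run_sweep_up:
  assumes "A \<inter> below X = {}"
    and "\<And>i. i < n \<Longrightarrow> V \<inter> below ((\<lambda>v. v div 2 ^ Suc i) ` X) \<subseteq>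
      (\<lambda>v. v div 2 ^ Suc i) ` X \<union> below ((\<lambda>v. v div 2 ^ i) ` X)"
  shows "run r (heap_graph V) A X (sweep_up n X) \<inter> below ((\<lambda>v. v div 2 ^ n) ` X) = {}"
  using assms
proof (induction n arbitrary: A X)
  case (Suc n)
  let ?H = "(\<lambda>v. v div 2) ` X"
  let ?B = "spread r (heap_graph V) X (X \<union> ?H) A"
  let ?D = "spread r (heap_graph V) (X \<union> ?H) ?H ?B"
  \<comment> \<open>Here \<open>X\<close> stays occupied and blocks every entrance to
    \<open>below X\<close>.\<close>
  have "?B \<inter> (below X \<union> (X \<union> ?H)) = {}"
    by (rule spread_guarded[OF Suc.prems(1)]) (use below_arc in blast)
  then have "?B \<inter> below X = {}" by blast
  \<comment> \<open>Now \<open>?H\<close> stays occupied, and an arc that enters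
    \<open>below X\<close> from outside starts in \<open>?H\<close>.\<close>
  then have "?D \<inter> (below X \<union> ?H) = {}"
    by (rule spread_guarded) (use below_arc in blast)
  moreover have "?D \<subseteq> V" using spread_subset[of r "heap_graph V"] by simp
  moreover have "V \<inter> below ?H \<subseteq> ?H \<union> below X" using Suc.prems(2)[of 0] by simp
  ultimately have D: "?D \<inter> below ?H = {}" by blast
  have "run r (heap_graph V) ?D ?H (sweep_up n ?H) \<inter> below ((\<lambda>v. v div 2 ^ n) ` ?H) = {}"
  proof (rule Suc.IH[OF D])
    show "V \<inter> below ((\<lambda>v. v div 2 ^ Suc i) ` ?H) \<subseteq>
      (\<lambda>v. v div 2 ^ Suc i) ` ?H \<union> below ((\<lambda>v. v div 2 ^ i) ` ?H)" if "i < n" for i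
      using Suc.prems(2)[of "Suc i"] that unfolding image_half_power by simp
  qed
  then show ?case unfolding image_half_power by simp
qed simp

text \<open>The game is played on the whole of \<open>V\<close> while the search recurses into
  subtrees, so subtrees are recognised as sets \<open>V \<inter> desc w\<close>.\<close>

lemma branch_One:
  assumes "V \<inter> desc w = places (One t) w" "0 < w"
  shows "V \<inter> desc (2 * w) = places t (2 * w)"
proof -
  have "w \<notin> desc (2 * w)" using desc_ge[of w "2 * w"] assms(2) by auto
  then show ?thesis
    using assms(1) desc_subset[OF desc_even[of w]] places_subset_desc[of t "2 * w"] by auto
qed

lemma branch_Two:
  assumes "V \<inter> desc w = places (Two s t) w" "0 < w"
  shows "V \<inter> desc (2 * w) = places s (2 * w)" "V \<inter> desc (Suc (2 * w)) = places t (Suc (2 * w))"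
proof -
  have notin: "w \<notin> desc (2 * w)" "w \<notin> desc (Suc (2 * w))"
    using desc_ge[of w "2 * w"] desc_ge[of w "Suc (2 * w)"] assms(2) by auto
  note sub = places_subset_desc[of s "2 * w"] places_subset_desc[of t "Suc (2 * w)"]
    and disj = desc_children_disjoint[OF assms(2)]
  have "V \<inter> desc (2 * w) = V \<inter> desc w \<inter> desc (2 * w)"
    "V \<inter> desc (Suc (2 * w)) = V \<inter> desc w \<inter> desc (Suc (2 * w))"
    using desc_subset[OF desc_even[of w]] desc_subset[OF desc_odd[of w]] by blast+
  note eqs = this[unfolded assms(1) places.simps]
  show "V \<inter> desc (2 * w) = places s (2 * w)"
    "V \<inter> desc (Suc (2 * w)) = places t (Suc (2 * w))"
    unfolding eqs using notin sub disj by blast+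
qed

lemma branch_chain:
  assumes "V \<inter> desc c = places ((One ^^ (i + j)) t) c" "0 < c"
  shows "V \<inter> desc (c * 2 ^ i) = places ((One ^^ j) t) (c * 2 ^ i)"
  using assms
proof (induction i arbitrary: c)
  case (Suc i)
  have "V \<inter> desc (2 * c) = places ((One ^^ (i + j)) t) (2 * c)"
    by (rule branch_One) (use Suc.prems in auto)
  from Suc.IH[OF this] Suc.prems(2) show ?case by (simp add: mult.left_commute mult.assoc)
qed simp

lemma chain_div: "i \<le> l \<Longrightarrow> c * 2 ^ l div 2 ^ i = c * 2 ^ (l - i)" for c :: nat
  by (metis div_mult_self_is_m le_add_diff_inverse2 mult.assoc power_add
      zero_less_numeral zero_less_power)

text \<open>A tail vertex \<open>q\<close> has \<open>2 * q\<close> as its only child in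
  \<open>V\<close>. This is the hypothesis of \<open>run_sweep_up\<close> along a tail.\<close>

lemma chain_step:
  assumes "V \<inter> desc c = places ((One ^^ l) t) c" "0 < c" "i < l"
  shows "V \<inter> desc (c * 2 ^ l div 2 ^ Suc i) \<subseteq>
    {c * 2 ^ l div 2 ^ Suc i} \<union> desc (c * 2 ^ l div 2 ^ i)"
proof -
  define q where "q = c * 2 ^ (l - Suc i)"
  have "V \<inter> desc q = places ((One ^^ Suc i) t) q"
    unfolding q_def using assms by (intro branch_chain) auto
  then have "V \<inter> desc q \<subseteq> {q} \<union> desc (2 * q)"
    using places_subset_desc[of "(One ^^ i) t" "2 * q"] by auto
  moreover have "c * 2 ^ l div 2 ^ Suc i = q" using assms(3) unfolding q_def by (intro chain_div) simp
  moreover have "c * 2 ^ l div 2 ^ i = 2 * q"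
  proof -
    have "l - i = Suc (l - Suc i)" using assms(3) by simp
    then show ?thesis using chain_div[of i l c] assms(3) unfolding q_def by simp
  qed
  ultimately show ?thesis by (simp only:)
qed

section \<open>Slow trees and their search\<close>

primrec duration :: "nat \<Rightarrow> nat \<Rightarrow> nat" where
  "duration r 0 = 1"
| "duration r (Suc h) = 2 * duration r h + 4 * (r * Suc (duration r h)) + 3"

text \<open>The robber may descend \<open>r\<close> levels in each of the
  \<open>duration r h\<close> rounds that search the right branch, and in one more round while the
  cops move to both lower tail ends.\<close>

definition tail_length :: "nat \<Rightarrow> nat \<Rightarrow> nat" where
  "tail_length r h = r * Suc (duration r h)"

primrec slow_tree :: "nat \<Rightarrow> nat \<Rightarrow> shape" where
  "slow_tree r 0 = Leaf"
| "slow_tree r (Suc h) = fork (tail_length r h) (slow_tree r h)"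

text \<open>The left branch is cleared up to \<open>2 * w\<close> and then abandoned, so that its
  cops can search the right one. The last sweep has \<open>Suc l\<close> levels: \<open>l\<close>
  along the tails and one in which both frontiers merge in \<open>w\<close>.\<close>

primrec search :: "nat \<Rightarrow> nat \<Rightarrow> nat \<Rightarrow> nat set list" where
  "search r 0 w = [{w}]"
| "search r (Suc h) w =
    (let l = tail_length r h; a = 2 * w * 2 ^ l; b = Suc (2 * w) * 2 ^ l
     in search r h a @ sweep_up l {a} @ search r h b @ [{a, b}] @ sweep_up (Suc l) {a, b})"

text \<open>Two recursive searches, \<open>2 * l\<close> rounds for the first sweep, one round for
  \<open>{a, b}\<close> and \<open>2 * l + 2\<close> rounds for the last sweep.\<close>

lemma length_search: "length (search r h w) = duration r h"
  by (induction h arbitrary: w) (auto simp: Let_def tail_length_def)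

text \<open>Four cops hold two frontier vertices together with their halves.\<close>

lemma small_search: "C \<in> set (search r h w) \<Longrightarrow> finite C \<and> card C \<le> 4"
proof (induction h arbitrary: w)
  case (Suc h)
  define l a b where "l = tail_length r h" and "a = 2 * w * 2 ^ l" and "b = Suc (2 * w) * 2 ^ l"
  have "C \<in> set (search r h a @ sweep_up l {a} @ search r h b @ [{a, b}] @ sweep_up (Suc l) {a, b})"
    using Suc.prems by (simp only: search.simps Let_def a_def b_def l_def)
  then consider "C \<in> set (search r h a)" | "C \<in> set (sweep_up l {a})" | "C \<in> set (search r h b)"
    | "C = {a, b}" | "C \<in> set (sweep_up (Suc l) {a, b})"
    by (auto simp del: sweep_up.simps)
  then show ?case
  proof cases
    case 2
    then show ?thesis using small_sweep_up[of "{a}"] by force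
  next
    case 4
    then show ?thesis by (simp add: card_insert_if)
  next
    case 5
    have "card {a, b} \<le> 2" by (simp add: card_insert_if)
    then show ?thesis using small_sweep_up[OF _ 5] by simp
  qed (use Suc.IH in blast)+
qed simp

lemma fork_div:
  "2 * w * 2 ^ l div 2 ^ Suc l = w" "Suc (2 * w) * 2 ^ l div 2 ^ Suc l = w" for w :: nat
proof -
  have "2 * w * 2 ^ l div 2 ^ l = 2 * w" "Suc (2 * w) * 2 ^ l div 2 ^ l = Suc (2 * w)"
    by simp_all
  then show "2 * w * 2 ^ l div 2 ^ Suc l = w" "Suc (2 * w) * 2 ^ l div 2 ^ Suc l = w"
    unfolding power_Suc2 div_mult2_eq by simp_all
qed

lemma last_search: "last (C # search r h w) = {w}"
proof (induction h arbitrary: w C)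
  case (Suc h)
  define l a b where "l = tail_length r h" and "a = 2 * w * 2 ^ l" and "b = Suc (2 * w) * 2 ^ l"
  have "last (C # search r (Suc h) w) = last ({a, b} # sweep_up (Suc l) {a, b})"
    by (simp add: Let_def a_def b_def l_def)
  also have "\<dots> = {w}"
    unfolding last_sweep_up a_def b_def image_insert image_empty fork_div by simp
  finally show ?case .
qed simp

lemma run_search:
  assumes "r \<le> R" "V \<inter> desc w = places (slow_tree R h) w" "0 < w"
  shows "run r (heap_graph V) A C (search R h w) \<inter> desc w = {}"
  using assms(2,3)
proof (induction h arbitrary: w A C)
  case 0
  then show ?case by (auto simp: spread_def)
next
  case (Suc h)
  define l a b where "l = tail_length R h" and "a = 2 * w * 2 ^ l" and "b = Suc (2 * w) * 2 ^ l"
  let ?G = "heap_graph V"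
  have shape: "V \<inter> desc w = places (fork l (slow_tree R h)) w" using Suc.prems by (simp add: l_def)
  have left: "V \<inter> desc (2 * w) = places ((One ^^ l) (slow_tree R h)) (2 * w)"
    and right: "V \<inter> desc (Suc (2 * w)) = places ((One ^^ l) (slow_tree R h)) (Suc (2 * w))"
    using branch_Two[OF shape[unfolded fork_def] Suc.prems(2)] .
  have a: "V \<inter> desc a = places (slow_tree R h) a" "0 < a"
    using branch_chain[of V "2 * w" l 0] left Suc.prems(2) by (auto simp: a_def)
  have b: "V \<inter> desc b = places (slow_tree R h) b" "0 < b"
    using branch_chain[of V "Suc (2 * w)" l 0] right by (auto simp: b_def)
  have div_a: "a div 2 ^ l = 2 * w" and div_b: "b div 2 ^ l = Suc (2 * w)"
    by (simp_all add: a_def b_def)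
  define A1 where "A1 = run r ?G A C (search R h a)"
  have "A1 \<inter> below {a} = {}" unfolding A1_def using Suc.IH[OF a] by (simp add: below_def)
  define A2 where "A2 = run r ?G A1 {a} (sweep_up l {a})"
  have "A2 \<inter> below ((\<lambda>v. v div 2 ^ l) ` {a}) = {}"
    unfolding A2_def using \<open>A1 \<inter> below {a} = {}\<close>
  proof (rule run_sweep_up)
    show "V \<inter> below ((\<lambda>v. v div 2 ^ Suc i) ` {a}) \<subseteq>
      (\<lambda>v. v div 2 ^ Suc i) ` {a} \<union> below ((\<lambda>v. v div 2 ^ i) ` {a})" if "i < l" for i
      using chain_step[OF left _ that] Suc.prems(2) unfolding a_def below_def by simp
  qed
  \<comment> \<open>The whole left branch is clear, stated in the form in which
    \<open>run_deep\<close> tracks its loss.\<close>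
  then have A2: "A2 \<inter> deep (2 * w) 0 = {}" by (simp add: below_def div_a)
  define C2 where "C2 = last ({a} # sweep_up l {a})"
  define A3 where "A3 = run r ?G A2 C2 (search R h b)"
  have A3: "A3 \<inter> desc b = {}" unfolding A3_def using Suc.IH[OF b] .
  have A3': "A3 \<inter> deep (2 * w) (R * duration R h) = {}"
    using run_deep[OF A2 assms(1), where V = V and C = C2 and Cs = "search R h b"]
    by (simp add: A3_def length_search)
  define A4 where "A4 = spread r ?G {b} {a, b} A3"
  have "A4 \<inter> deep (2 * w) (R * duration R h + R) = {}"
    unfolding A4_def using A3' assms(1) by (rule spread_deep)
  \<comment> \<open>Even after the extra round only depths below \<open>l\<close> can be lost, and
    \<open>a\<close> lies \<open>l\<close> levels under \<open>2 * w\<close>.\<close>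
  moreover have "desc a \<subseteq> deep (2 * w) (R * duration R h + R)"
    using desc_subset_deep[of "2 * w" l] unfolding a_def by (simp add: l_def tail_length_def add.commute)
  ultimately have "A4 \<inter> desc a = {}" by blast
  \<comment> \<open>The cop on \<open>b\<close> stays there in this round and guards
    \<open>desc b\<close>.\<close>
  moreover have "A4 \<inter> (desc b \<union> {a, b}) = {}"
    unfolding A4_def using A3
  proof (rule spread_guarded)
    show "x \<in> desc b"
      if "(x, y) \<in> parcs ?G" "y \<notin> {b} \<inter> {a, b}" "y \<in> desc b" for x y
      using below_arc[of x y V "{b}"] that by (auto simp: below_def)
  qed
  ultimately have "A4 \<inter> below {a, b} = {}" by (auto simp: below_def)
  then have "run r ?G A4 {a, b} (sweep_up (Suc l) {a, b})
    \<inter> below ((\<lambda>v. v div 2 ^ Suc l) ` {a, b}) = {}"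
  proof (rule run_sweep_up)
    fix i assume "i < Suc l"
    then consider "i < l" | "i = l" by linarith
    then show "V \<inter> below ((\<lambda>v. v div 2 ^ Suc i) ` {a, b}) \<subseteq>
      (\<lambda>v. v div 2 ^ Suc i) ` {a, b} \<union> below ((\<lambda>v. v div 2 ^ i) ` {a, b})"
    proof cases
      case 1
      have "V \<inter> desc (a div 2 ^ Suc i) \<subseteq> {a div 2 ^ Suc i} \<union> desc (a div 2 ^ i)"
        unfolding a_def using chain_step[OF left _ 1] Suc.prems(2) by simp
      moreover have "V \<inter> desc (b div 2 ^ Suc i) \<subseteq> {b div 2 ^ Suc i} \<union> desc (b div 2 ^ i)"
        unfolding b_def using chain_step[OF right _ 1] by simp
      ultimately show ?thesis unfolding below_def by blast
    next
      case 2
      \<comment> \<open>In the last step both frontiers merge in \<open>w\<close>, whose two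
        children have just been held.\<close>
      have "a div 2 ^ Suc l = w" "b div 2 ^ Suc l = w"
        unfolding a_def b_def by (rule fork_div)+
      moreover have "V \<inter> desc w \<subseteq> {w} \<union> (desc (2 * w) \<union> desc (Suc (2 * w)))"
        using shape places_subset_desc[of _ "2 * w"] places_subset_desc[of _ "Suc (2 * w)"]
        unfolding fork_def places.simps by blast
      ultimately show ?thesis using div_a div_b unfolding 2 below_def by simp
    qed
  qed
  moreover have "(\<lambda>v. v div 2 ^ Suc l) ` {a, b} = {w}"
    unfolding a_def b_def image_insert image_empty fork_div by simp
  moreover have "run r ?G A C (search R (Suc h) w) = run r ?G A4 {a, b} (sweep_up (Suc l) {a, b})"
  proof -
    have "run r ?G A C (search R (Suc h) w) =
      run r ?G A C (search R h a @ sweep_up l {a} @ search R h b @ [{a, b}] @ sweep_up (Suc l) {a, b})"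
      by (simp only: search.simps Let_def a_def b_def l_def)
    also have "\<dots> = run r ?G A2 C2 (search R h b @ [{a, b}] @ sweep_up (Suc l) {a, b})"
      by (simp only: run_append last_search A1_def A2_def C2_def)
    also have "\<dots> = run r ?G A3 {b} ([{a, b}] @ sweep_up (Suc l) {a, b})"
      by (simp only: run_append last_search A3_def)
    finally show ?thesis by (simp only: append_Cons append_Nil run.simps A4_def)
  qed
  ultimately show ?case by (simp only: below_def) simp
qed

text \<open>One parameter serves as height and as speed: the height makes the cuts grow, and the
  tails are long enough for all robbers of speed at most \<open>d\<close>.\<close>

definition slow_graph :: "nat \<Rightarrow> nat pair_pre_digraph" where
  "slow_graph d = heap_graph (places (slow_tree d d) 1)"

lemma slow_graph_cops_win:
  assumes "r \<le> d"
  shows "\<exists>Cs. cops_win r (slow_graph d) Cs \<and> num_cops Cs \<le> 4"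
proof -
  let ?V = "places (slow_tree d d) 1"
  let ?S = "search d d 1"
  \<comment> \<open>The empty first position makes the initial area all of \<open>?V\<close>, so
    that \<open>run\<close> executes every position of \<open>?S\<close>.\<close>
  define Cs where "Cs = map (\<lambda>C. C \<inter> ?V) ({} # ?S)"
  have V: "?V \<inter> desc 1 = ?V" using places_subset_desc[of "slow_tree d d" 1] by blast
  have "robber_area r (heap_graph ?V) Cs (length ?S) = robber_area r (heap_graph ?V) ({} # ?S) (length ?S)"
    unfolding Cs_def using robber_area_Int_verts[of "length ?S" "{} # ?S" r "heap_graph ?V"] by simp
  also have "\<dots> = run r (heap_graph ?V) ?V {} ?S"
    by (subst robber_area_eq_run) simp_all
  finally have area: "robber_area r (heap_graph ?V) Cs (length ?S) = run r (heap_graph ?V) ?V {} ?S" .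
  then have "robber_area r (heap_graph ?V) Cs (length ?S) \<inter> desc 1 = {}"
    using run_search[OF assms V] by simp
  moreover have "robber_area r (heap_graph ?V) Cs (length ?S) \<subseteq> ?V"
    by (cases "length ?S") auto
  ultimately have "robber_area r (heap_graph ?V) Cs (length Cs - 1) = {}"
    using V by (simp add: Cs_def) blast
  then have "cops_win r (slow_graph d) Cs"
    by (auto simp: cops_win_def blind_strategy_def slow_graph_def Cs_def)
  moreover have "num_cops Cs \<le> 4"
  proof -
    have "card C \<le> 4" if "C \<in> set Cs" for C
    proof -
      have "C \<in> (\<lambda>C. C \<inter> ?V) ` set ({} # ?S)" using that unfolding Cs_def set_map .
      then obtain D where D: "D \<in> set ({} # ?S)" "C = D \<inter> ?V" by blast
      then have "finite D \<and> card D \<le> 4" using small_search by fastforce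
      then show ?thesis using D(2) card_mono[of D "D \<inter> ?V"] by auto
    qed
    then show ?thesis by (auto simp: num_cops_def Cs_def)
  qed
  ultimately show ?thesis by blast
qed

subsection \<open>From cops to flips\<close>

lemma card_neighbours_subcubic:
  assumes "subcubic G" "pair_graph G" "c \<in> pverts G"
  shows "finite {v. (c, v) \<in> parcs G} \<and> card {v. (c, v) \<in> parcs G} \<le> 3"
proof -
  interpret pair_graph G by fact
  have nb: "{v. (c, v) \<in> parcs G} = snd ` out_arcs (with_proj G) c"
    by (force simp: out_arcs_def)
  have "out_arcs (with_proj G) c \<subseteq> parcs G" by (auto simp: out_arcs_def)
  then have fin: "finite (out_arcs (with_proj G) c)" by (rule finite_subset) (rule pair_finite_arcs)
  then have "card {v. (c, v) \<in> parcs G} \<le> out_degree (with_proj G) c"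
    unfolding nb out_degree_def by (rule card_image_le)
  also have "\<dots> \<le> 3" using assms by (simp add: subcubic_def)
  finally show ?thesis using fin nb by simp
qed

definition closed_neighbourhood :: "'a pair_pre_digraph \<Rightarrow> 'a set \<Rightarrow> 'a set" where
  "closed_neighbourhood G C = (\<Union>c \<in> C. insert c {v. (c, v) \<in> parcs G})"

text \<open>
  Making the vertices of \<open>C\<close> and all their neighbours singleton parts allows the flip to remove
  exactly the edges at \<open>C\<close>; bounded degree keeps the number of parts linear in \<open>card C\<close>.
\<close>

definition isolating_flip :: "'a pair_pre_digraph \<Rightarrow> 'a set \<Rightarrow> 'a flip" where
  "isolating_flip G C =
    (let \<P> = (\<lambda>v. {v}) ` closed_neighbourhood G C \<union> ({pverts G - closed_neighbourhood G C} - {{}})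
     in (\<P>, \<lparr> pverts = \<P>,
              parcs = {({u}, {v}) | u v. (u, v) \<in> parcs G \<and> (u \<in> C \<or> v \<in> C)} \<rparr>))"

lemma is_flip_isolating_flip:
  assumes "pair_graph G" "subcubic G" "C \<subseteq> pverts G"
  shows "is_flip (4 * card C + 1) G (isolating_flip G C)"
proof -
  interpret pair_graph G by fact
  define S where "S = closed_neighbourhood G C"
  define \<P> where "\<P> = (\<lambda>v. {v}) ` S \<union> ({pverts G - S} - {{}})"
  define F where "F = \<lparr> pverts = \<P>,
    parcs = {({u}, {v}) | u v. (u, v) \<in> parcs G \<and> (u \<in> C \<or> v \<in> C)} \<rparr>"
  have flip: "isolating_flip G C = (\<P>, F)"
    by (simp add: isolating_flip_def S_def \<P>_def F_def Let_def)
  have finC: "finite C" using assms(3) pair_finite_verts by (rule finite_subset)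
  have SV: "S \<subseteq> pverts G"
    using assms(3) in_arcsD2 by (auto simp: S_def closed_neighbourhood_def)
  then have finS: "finite S" using pair_finite_verts by (rule finite_subset)
  have "card S \<le> (\<Sum>c \<in> C. card (insert c {v. (c, v) \<in> parcs G}))"
    unfolding S_def closed_neighbourhood_def using finC by (rule card_UN_le)
  also have "\<dots> \<le> (\<Sum>c \<in> C. 4)"
  proof (rule sum_mono)
    fix c assume "c \<in> C"
    then have "finite {v. (c, v) \<in> parcs G} \<and> card {v. (c, v) \<in> parcs G} \<le> 3"
      using card_neighbours_subcubic[OF assms(2,1)] assms(3) by blast
    then show "card (insert c {v. (c, v) \<in> parcs G}) \<le> 4" by (simp add: card_insert_if)
  qed
  finally have cardS: "card S \<le> 4 * card C" by simp
  have "card \<P> \<le> card ((\<lambda>v. {v}) ` S) + card ({pverts G - S} - {{}})"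
    unfolding \<P>_def by (rule card_Un_le)
  also have "\<dots> \<le> 4 * card C + 1"
    using cardS card_image_le[OF finS, of "\<lambda>v. {v}"]
      card_mono[of "{pverts G - S}" "{pverts G - S} - {{}}"]
    by simp
  finally have card: "card \<P> \<le> 4 * card C + 1" .
  have part: "partition_on (pverts G) \<P>"
    by (rule partition_onI) (use SV in \<open>auto simp: \<P>_def disjnt_def\<close>)
  have nb: "u \<in> S \<and> v \<in> S" if "(u, v) \<in> parcs G" "u \<in> C \<or> v \<in> C" for u v
  proof -
    have "(v, u) \<in> parcs G" using that(1) pair_sym_arcs by (auto simp: symmetric_def sym_def)
    then show ?thesis using that by (auto simp: S_def closed_neighbourhood_def)
  qed
  have arcs: "parcs F \<subseteq> \<P> \<times> \<P>"
    using nb by (auto simp: F_def \<P>_def)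
  have pverts_F: "pverts F = \<P>" by (simp add: F_def)
  have "finite \<P>" using finS by (simp add: \<P>_def)
  have "pair_pseudo_graph F"
  proof
    show "fst e \<in> pverts F" "snd e \<in> pverts F" if "e \<in> parcs F" for e
      using subsetD[OF arcs that] by (simp_all add: mem_Times_iff pverts_F)
    show "finite (pverts F)" using \<open>finite \<P>\<close> by (simp add: F_def)
    show "finite (parcs F)" by (rule finite_subset[OF arcs]) (use \<open>finite \<P>\<close> in simp)
    show "symmetric (with_proj F)"
      using pair_sym_arcs unfolding symmetric_def sym_def by (auto simp: F_def)
  qed
  then show ?thesis using card part by (simp add: is_flip_def flip) (simp add: F_def)
qed

text \<open>Both ends of an arc at \<open>C\<close> lie in singleton parts, so flipping this pair of
  parts affects no other edge.\<close>

lemma flip_graph_isolating_flip: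
  assumes "pair_graph G"
  shows "pverts (flip_graph G (isolating_flip G C)) = pverts G"
    "(u, v) \<in> parcs (flip_graph G (isolating_flip G C)) \<longleftrightarrow>
      (u, v) \<in> parcs G \<and> u \<notin> C \<and> v \<notin> C"
proof -
  interpret pair_graph G by fact
  have sym: "(y, x) \<in> parcs G" if "(x, y) \<in> parcs G" for x y
    using that pair_sym_arcs by (auto simp: symmetric_def sym_def)
  define S where "S = closed_neighbourhood G C"
  define \<P> where "\<P> = (\<lambda>v. {v}) ` S \<union> ({pverts G - S} - {{}})"
  define E where "E = {({u}, {v}) | u v. (u, v) \<in> parcs G \<and> (u \<in> C \<or> v \<in> C)}"
  have flip: "isolating_flip G C = (\<P>, \<lparr> pverts = \<P>, parcs = E \<rparr>)"
    by (simp add: isolating_flip_def S_def \<P>_def E_def Let_def)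
  show "pverts (flip_graph G (isolating_flip G C)) = pverts G"
    by (simp add: flip_graph_def flip)
  have "(\<exists>P \<in> \<P>. \<exists>Q \<in> \<P>. u \<in> P \<and> v \<in> Q \<and> (P, Q) \<in> E) \<longleftrightarrow>
    (u, v) \<in> parcs G \<and> (u \<in> C \<or> v \<in> C)" (is "?L = ?R")
  proof
    assume ?L
    then show ?R by (auto simp: E_def)
  next
    assume R: ?R
    then have "u \<in> S" "v \<in> S" using sym by (auto simp: S_def closed_neighbourhood_def)
    then have "{u} \<in> \<P>" "{v} \<in> \<P>" by (auto simp: \<P>_def)
    moreover have "({u}, {v}) \<in> E" using R by (auto simp: E_def)
    ultimately show ?L by blast
  qed
  then show "(u, v) \<in> parcs (flip_graph G (isolating_flip G C)) \<longleftrightarrow>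
      (u, v) \<in> parcs G \<and> u \<notin> C \<and> v \<notin> C"
    using in_arcsD1 in_arcsD2 pair_no_loops[of "(u, v)"] by (auto simp: flip_graph_def flip)
qed

text \<open>\<open>C\<close> is isolated in the flipped graph, so a path from outside
  \<open>C\<close> avoids all of \<open>C\<close>, in particular the cops that stay.\<close>

lemma reach_within_isolating_flip:
  assumes G: "pair_graph G"
    and reach: "reach_within r (with_proj (flip_graph G (isolating_flip G C))) u v" and "u \<notin> C"
  shows "reach_within r (with_proj G \<restriction> (pverts G - (C \<inter> C'))) u v"
proof -
  let ?H = "with_proj (flip_graph G (isolating_flip G C))"
  note flip = flip_graph_isolating_flip[OF G, where C = C]
  obtain p where p: "vwalk p ?H" "distinct p" "hd p = u" "last p = v" "vwalk_length p \<le> r"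
    using reach by (auto simp: reach_within_def vpath_def)
  have avoid: "set p \<inter> C = {}"
    using p(1) \<open>u \<notin> C\<close> unfolding p(3)[symmetric]
    by (induction p rule: vwalk_induct) (auto simp: flip)
  have "set p \<subseteq> pverts G" "set (vwalk_arcs p) \<subseteq> parcs G" "p \<noteq> []"
    using p(1) by (auto simp: vwalk_def flip)
  moreover have "set (vwalk_arcs p) \<subseteq> arcs_ends (with_proj G \<restriction> (pverts G - (C \<inter> C')))"
  proof -
    have ends: "(x, y) \<in> set (vwalk_arcs p) \<Longrightarrow> x \<in> set p \<and> y \<in> set p" for x y
      by (induction p rule: vwalk_arcs.induct) auto
    show ?thesis
    proof (rule subrelI)
      fix x y assume xy: "(x, y) \<in> set (vwalk_arcs p)"
      then have "(x, y) \<in> parcs G" using \<open>set (vwalk_arcs p) \<subseteq> parcs G\<close> by blast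
      moreover have "x \<in> pverts G - (C \<inter> C')" "y \<in> pverts G - (C \<inter> C')"
        using ends[OF xy] avoid \<open>set p \<subseteq> pverts G\<close> by blast+
      ultimately show "(x, y) \<in> arcs_ends (with_proj G \<restriction> (pverts G - (C \<inter> C')))"
        by (simp add: arcs_ends_induce_subgraph)
    qed
  qed
  moreover have "set p \<subseteq> verts (with_proj G \<restriction> (pverts G - (C \<inter> C')))"
    unfolding induce_subgraph_verts using avoid \<open>set p \<subseteq> pverts G\<close> by blast
  ultimately have "vwalk p (with_proj G \<restriction> (pverts G - (C \<inter> C')))"
    by (intro vwalkI)
  then show ?thesis using p unfolding reach_within_def vpath_def by blast
qed

text \<open>The index is shifted because the first move of the runner takes place in the unflipped
  graph. Afterwards the runner has to avoid all of \<open>Cs ! i\<close>, the robber only the cops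
  that stay; being non-isolated keeps the runner off the new cops.\<close>

lemma runner_area_subset_robber_area:
  assumes G: "pair_graph G" and "i < length Cs"
  shows "runner_area r G (map (isolating_flip G) Cs) (Suc i) \<subseteq> robber_area r G Cs i"
  using assms(2)
proof (induction i)
  case 0
  then show ?case
    by (auto simp: nonisolated_def flip_graph_isolating_flip[OF G])
next
  case (Suc i)
  let ?fs = "map (isolating_flip G) Cs"
  show ?case
  proof
    fix v assume "v \<in> runner_area r G ?fs (Suc (Suc i))"
    then obtain u where v: "v \<in> nonisolated (flipped_graph G ?fs (Suc (Suc i)))"
      and u: "u \<in> runner_area r G ?fs (Suc i)"
      and reach: "reach_within r (with_proj (flipped_graph G ?fs (Suc i))) u v"
      unfolding runner_area.simps(2)[of r G ?fs "Suc i"] by blast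
    have robber: "u \<in> robber_area r G Cs i" using u Suc by auto
    then have "u \<notin> Cs ! i" by (cases i) auto
    have "reach_within r (with_proj (flip_graph G (isolating_flip G (Cs ! i)))) u v"
      using reach Suc.prems by simp
    from reach_within_isolating_flip[OF G this \<open>u \<notin> Cs ! i\<close>]
    have "reach_within r (with_proj G \<restriction> (pverts G - (Cs ! i \<inter> Cs ! Suc i))) u v" .
    moreover have "v \<in> pverts G - Cs ! Suc i"
      using v Suc.prems by (auto simp: nonisolated_def flip_graph_isolating_flip[OF G])
    ultimately show "v \<in> robber_area r G Cs (Suc i)" using robber by auto
  qed
qed

lemma is_flip_mono: "is_flip k G f \<Longrightarrow> k \<le> k' \<Longrightarrow> is_flip k' G f"
  by (auto simp: is_flip_def split: prod.splits)

lemma bfw_le_num_cops: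
  assumes "pair_graph G" "subcubic G" "cops_win r G Cs"
  shows "bfw r G \<le> 4 * num_cops Cs + 1"
proof -
  have Cs: "Cs \<noteq> []" "\<forall>C \<in> set Cs. C \<subseteq> pverts G" "robber_area r G Cs (length Cs - 1) = {}"
    using assms(3) by (auto simp: cops_win_def blind_strategy_def)
  have "is_flip (4 * num_cops Cs + 1) G (isolating_flip G C)" if "C \<in> set Cs" for C
  proof (rule is_flip_mono)
    show "is_flip (4 * card C + 1) G (isolating_flip G C)"
      using is_flip_isolating_flip[OF assms(1,2)] Cs(2) that by blast
    show "4 * card C + 1 \<le> 4 * num_cops Cs + 1" using that by (simp add: num_cops_def)
  qed
  moreover have "runner_area r G (map (isolating_flip G) Cs) (length Cs) = {}"
    using runner_area_subset_robber_area[OF assms(1), of "length Cs - 1" Cs r] Cs by simp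
  ultimately have "flipper_wins r (4 * num_cops Cs + 1) G (map (isolating_flip G) Cs)"
    using Cs(1) by (auto simp: flipper_wins_def)
  then show ?thesis unfolding bfw_def by (intro Least_le) blast
qed

subsection \<open>The class\<close>

lemma bcw_le_num_cops: "cops_win r G Cs \<Longrightarrow> bcw r G \<le> num_cops Cs"
  unfolding bcw_def by (intro Least_le) blast

lemma cops_win_everywhere: "cops_win r G [pverts G]"
  by (simp add: cops_win_def blind_strategy_def)

text \<open>For speed \<open>r\<close> only the finitely many trees with \<open>d < r\<close> may
  have tails that are too short. There a cop on every vertex wins at once, and the sum bounds the
  sizes of all these trees.\<close>

lemma slow_graph_cops_win_bounded:
  "\<exists>Cs. cops_win r (slow_graph d) Cs \<and> num_cops Cs \<le> 4 + (\<Sum>e<r. card (pverts (slow_graph e)))"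
proof (cases "r \<le> d")
  case True
  then show ?thesis using slow_graph_cops_win[of r d] by (meson le_trans le_add1)
next
  case False
  then have "card (pverts (slow_graph d)) \<le> (\<Sum>e<r. card (pverts (slow_graph e)))"
    by (intro member_le_sum) auto
  then have "num_cops [pverts (slow_graph d)] \<le> 4 + (\<Sum>e<r. card (pverts (slow_graph e)))"
    by (simp add: num_cops_def)
  then show ?thesis using cops_win_everywhere by blast
qed

lemma card_places_slow_tree: "0 < w \<Longrightarrow> h < card (places (slow_tree r h) w)"
proof (induction h arbitrary: w)
  case (Suc h)
  let ?l = "tail_length r h"
  have "h < card (places (slow_tree r h) (2 * w * 2 ^ ?l))" using Suc by simp
  moreover have "\<dots> < card (places (slow_tree r (Suc h)) w)"
    using card_places_fork[OF Suc.prems] by simp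
  ultimately show ?case by linarith
qed simp

text \<open>Height \<open>m\<close> gives more than \<open>m\<close> vertices and so width 1 by
  \<open>wide_one\<close>; every two further levels add one.\<close>

lemma wide_slow_tree: "wide m (Suc j) (slow_tree r (m + 2 * j))"
proof (induction j)
  case 0
  show ?case using wide_one[of m "slow_tree r m"] card_places_slow_tree[of _ m r] by simp
next
  case (Suc j)
  from wide_fork_fork[OF Suc] show ?case by simp
qed

theorem theorem5p1:
  shows "\<exists>\<C> :: nat pair_pre_digraph set.
    (\<forall>G \<in> \<C>. undirected_tree G \<and> subcubic G) \<and>
    (\<forall>r \<ge> 1. bounded_bcw r \<C>) \<and>
    \<not> bdd_above (pathwidth ` \<C>) \<and>
    bounded_bfw \<C> \<and>
    \<not> bdd_above (linear_cliquewidth ` \<C>)"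
proof (intro exI[of _ "range slow_graph"] conjI)
  define N where "N r = 4 + (\<Sum>e<r. card (pverts (slow_graph e)))" for r
  have N: "\<exists>Cs. cops_win r (slow_graph d) Cs \<and> num_cops Cs \<le> N r" for r d
    unfolding N_def by (rule slow_graph_cops_win_bounded)
  have tree: "undirected_tree (slow_graph d)" "subcubic (slow_graph d)" for d
    unfolding slow_graph_def by (rule undirected_tree_heap_graph subcubic_heap_graph; simp)+
  then show "\<forall>G \<in> range slow_graph. undirected_tree G \<and> subcubic G" by blast
  have "bcw r (slow_graph d) \<le> N r" for r d
    using N[of r d] bcw_le_num_cops le_trans by blast
  then show "\<forall>r \<ge> 1. bounded_bcw r (range slow_graph)"
    unfolding bounded_bcw_def by (auto intro!: bdd_aboveI2)
  have "bfw r (slow_graph d) \<le> 4 * N r + 1" for r d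
  proof -
    obtain Cs where Cs: "cops_win r (slow_graph d) Cs" "num_cops Cs \<le> N r"
      using N by blast
    have "pair_graph (slow_graph d)" using tree(1) by (simp add: undirected_tree_def)
    then have "bfw r (slow_graph d) \<le> 4 * num_cops Cs + 1"
      using tree(2) Cs(1) by (rule bfw_le_num_cops)
    then show ?thesis using Cs(2) by linarith
  qed
  then show "bounded_bfw (range slow_graph)"
    unfolding bounded_bfw_def by (intro exI[of _ "\<lambda>r. 4 * N r + 1"]) blast
  show "\<not> bdd_above (pathwidth ` range slow_graph)"
  proof
    assume "bdd_above (pathwidth ` range slow_graph)"
    then obtain b where b: "pathwidth (slow_graph d) \<le> b" for d
      by (auto simp: bdd_above_def)
    \<comment> \<open>The index is \<open>m + 2 * j\<close> with \<open>m = Suc b\<close> and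
      \<open>j = 3 * m\<close>, as \<open>wide_imp_pathwidth\<close> demands.\<close>
    have "Suc b \<le> pathwidth (slow_graph (Suc b + 2 * (3 * Suc b)))"
      unfolding slow_graph_def by (rule wide_imp_pathwidth[OF wide_slow_tree]) simp
    then show False using b not_less_eq_eq by blast
  qed
  show "\<not> bdd_above (linear_cliquewidth ` range slow_graph)"
  proof
    assume "bdd_above (linear_cliquewidth ` range slow_graph)"
    then obtain b where b: "linear_cliquewidth (slow_graph d) \<le> b" for d
      by (auto simp: bdd_above_def)
    \<comment> \<open>Creation times are distinct, so here \<open>m = 1\<close>, with
      \<open>j = 9 * b\<close>.\<close>
    have "b < linear_cliquewidth (slow_graph (1 + 2 * (9 * b)))"
      unfolding slow_graph_def by (rule wide_imp_linear_cliquewidth[OF wide_slow_tree]) simp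
    then show False using b not_less by blast
  qed
qed

end
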